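(* For $n\ge 1$ let $\Sigma_n$ denote the set of all mappings $g:\{1,\dots,n\}\to\{1,\dots,n\}$, and let $g$ be chosen uniformly at random from $\Sigma_n$. The probability that $g$ possesses a unique highest tree is, as $n\to\infty$, $$1-\sqrt{\frac{\pi}{8}}\;n^{-1/2}+\mathcal{O}(n^{-1}).$$
   Context: The functional graph of a mapping $g:\{1,\dots,n\}\to\{1,\dots,n\}$ is the digraph on $\{1,\dots,n\}$ with an edge $x\to g(x)$ for each $x$. It decomposes uniquely into weakly connected components, each consisting of a directed cycle of rooted trees. A vertex $x$ is cyclic if $g^k(x)=x$ for some $k\ge 1$; the set of cyclic vertices is the cycle core. For each cyclic vertex $x$, the tree of $g$ rooted at $x$ consists of all vertices $y$ such that $x$ is the first cyclic vertex in the sequence $y, g(y), g^2(y),\dots$ (so $x$ itself belongs to it and is its root). The height of a tree is the maximum, over its vertices $y$, of the number of edges on the path from $y$ to the root; a tree consisting only of its root has height $0$. The mapping $g$ possesses a unique highest tree if, among all trees of $g$ (over all cyclic vertices in all components), exactly one attains the maximum height. *)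

theory Defs
  imports "HOL-Probability.Probability_Mass_Function" "HOL-Library.Landau_Symbols"
begin

definition mappings :: "nat \<Rightarrow> (nat \<Rightarrow> nat) set" where
  "mappings n = {1..n} \<rightarrow>\<^sub>E {1..n}"

definition cycle_core :: "nat \<Rightarrow> (nat \<Rightarrow> nat) \<Rightarrow> nat set" where
  "cycle_core n g = {x \<in> {1..n}. \<exists>k\<ge>1. (g ^^ k) x = x}"

text \<open>
  The first cyclic vertex in the sequence \<open>y, g y, g (g y), \<dots>\<close> is the root of the tree
  containing \<open>y\<close>; its position in that sequence is the number of edges on the path from \<open>y\<close>
  to the root. For \<open>y \<in> {1..n}\<close> and \<open>g \<in> mappings n\<close> such a position exists, so that
  \<open>LEAST\<close> is meaningful.
\<close>

definition depth :: "nat \<Rightarrow> (nat \<Rightarrow> nat) \<Rightarrow> nat \<Rightarrow> nat" where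
  "depth n g y = (LEAST k. (g ^^ k) y \<in> cycle_core n g)"

definition root_of :: "nat \<Rightarrow> (nat \<Rightarrow> nat) \<Rightarrow> nat \<Rightarrow> nat" where
  "root_of n g y = (g ^^ depth n g y) y"

definition tree_at :: "nat \<Rightarrow> (nat \<Rightarrow> nat) \<Rightarrow> nat \<Rightarrow> nat set" where
  "tree_at n g x = {y \<in> {1..n}. root_of n g y = x}"

definition tree_height :: "nat \<Rightarrow> (nat \<Rightarrow> nat) \<Rightarrow> nat \<Rightarrow> nat" where
  "tree_height n g x = Max (depth n g ` tree_at n g x)"

text \<open>
  Trees with different roots are different, so counting trees amounts to counting their roots.
\<close>

definition unique_highest_tree :: "nat \<Rightarrow> (nat \<Rightarrow> nat) \<Rightarrow> bool" where
  "unique_highest_tree n g \<longleftrightarrow>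
     (\<exists>!x. x \<in> cycle_core n g \<and> tree_height n g x = Max (tree_height n g ` cycle_core n g))"

end

theory Submission
  imports Defs "HOL-Probability.Probability" "HOL-Computational_Algebra.Formal_Power_Series"
    "HOL-Combinatorics.Permutations" "HOL-Real_Asymp.Real_Asymp"
begin

text \<open>
  Let \<open>A\<^sub>h\<close> be the exponential generating function of rooted trees of height less than \<open>h\<close>, so that
  \<open>A\<^sub>h\<^sub>+\<^sub>1 = X exp A\<^sub>h\<close>, and let \<open>D\<^sub>h = A\<^sub>h\<^sub>+\<^sub>1 - A\<^sub>h\<close>, \<open>U\<^sub>h = 1 / (1 - A\<^sub>h)\<close> and \<open>T = lim A\<^sub>h\<close>
  (\<open>A\<close>, \<open>D\<close>, \<open>U\<close> are called \<open>tree_egf\<close>, \<open>height_egf\<close>, \<open>seq_egf\<close> below). The mappings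
  without a unique highest tree have generating function \<open>\<Sum>h. D\<^sub>h\<^sup>2 U\<^sub>h\<^sup>2 U\<^sub>h\<^sub>+\<^sub>1\<close>.
  No singularity analysis is needed to extract its coefficients: since
  \<open>D\<^sub>h\<^sub>+\<^sub>1 = A\<^sub>h\<^sub>+\<^sub>1 D\<^sub>h + O(D\<^sub>h\<^sup>2)\<close>, summation by parts of \<open>\<Sum>h. U\<^sub>h\<^sub>+\<^sub>1\<^sup>2 (D\<^sub>h - D\<^sub>h\<^sub>+\<^sub>1)\<close> turns twice this
  series into \<open>\<Sum>h. U\<^sub>h\<^sub>+\<^sub>1 D\<^sub>h\<close>, which telescopes to \<open>log (1 / (1 - T))\<close>, up to errors dominated
  coefficientwise by a polynomial in \<open>T\<close>; the domination rests on summation by parts with the weights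
  \<open>U\<^sub>h\<close>, \<open>U\<^sub>h\<^sup>2\<close>, \<open>U\<^sub>h\<^sup>3\<close>, where all boundary terms are nonnegative or vanish. The coefficients of powers of \<open>T\<close>
  are \<open>O(n\<^sup>n\<^sup>-\<^sup>1 / n!)\<close>, which relative to \<open>n\<^sup>n / n!\<close> is within the claimed error,
  and the coefficients of the logarithm are given by
  Ramanujan's function \<open>Q(n) = \<Sum>k=1..n. n! / ((n - k)! n\<^sup>k) = sqrt (pi n / 2) + O(1)\<close>.
\<close>

unbundle no vec_syntax and fps_syntax

section \<open>Coefficientwise domination of power series\<close>

definition fps_le :: "nat \<Rightarrow> real fps \<Rightarrow> real fps \<Rightarrow> bool" where
  "fps_le N f g \<longleftrightarrow> (\<forall>i\<le>N. f $ i \<le> g $ i)"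

lemma fps_le_refl [simp]: "fps_le N f f"
  by (simp add: fps_le_def)

lemma fps_le_trans [trans]: "fps_le N f g \<Longrightarrow> fps_le N g h \<Longrightarrow> fps_le N f h"
  unfolding fps_le_def using order_trans by blast

lemma fps_le_nth: "fps_le N f g \<Longrightarrow> i \<le> N \<Longrightarrow> f $ i \<le> g $ i"
  by (simp add: fps_le_def)

lemma fps_le_add: "fps_le N f g \<Longrightarrow> fps_le N f' g' \<Longrightarrow> fps_le N (f + f') (g + g')"
  by (simp add: fps_le_def add_mono)

lemma fps_le_sum: "(\<And>x. x \<in> S \<Longrightarrow> fps_le N (f x) (g x)) \<Longrightarrow> fps_le N (sum f S) (sum g S)"
  by (simp add: fps_le_def fps_sum_nth sum_mono)

lemma fps_le_diff_iff: "fps_le N f g \<longleftrightarrow> fps_le N 0 (g - f)"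
  by (simp add: fps_le_def)

lemma fps_le_diff_left: "fps_le N g f \<Longrightarrow> fps_le N (k - f) (k - g)"
  by (simp add: fps_le_def)

lemma fps_le_0_mult: "fps_le N 0 f \<Longrightarrow> fps_le N 0 g \<Longrightarrow> fps_le N 0 (f * g)"
  unfolding fps_le_def fps_mult_nth
  by (auto intro!: sum_nonneg mult_nonneg_nonneg)

lemma fps_le_0_add: "fps_le N 0 f \<Longrightarrow> fps_le N 0 g \<Longrightarrow> fps_le N 0 (f + g)"
  unfolding fps_le_def by auto

lemma fps_le_0_1 [simp]: "fps_le N 0 1"
  by (simp add: fps_le_def)

lemma fps_le_0_X [simp]: "fps_le N 0 fps_X"
  by (simp add: fps_le_def fps_X_def)

lemma fps_le_0_power: "fps_le N 0 f \<Longrightarrow> fps_le N 0 (f ^ k)"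
  by (induction k) (auto intro: fps_le_0_mult)

lemma fps_le_0_sum: "(\<And>x. x \<in> S \<Longrightarrow> fps_le N 0 (f x)) \<Longrightarrow> fps_le N 0 (sum f S)"
  using fps_le_sum[of S N "\<lambda>_. 0" f] by simp

lemma fps_le_mult_left:
  assumes "fps_le N f g" "fps_le N 0 k"
  shows "fps_le N (k * f) (k * g)"
proof -
  have "fps_le N 0 (k * (g - f))"
    using assms by (intro fps_le_0_mult) (auto simp: fps_le_diff_iff[symmetric])
  then show ?thesis
    by (subst fps_le_diff_iff) (simp add: algebra_simps)
qed

lemma fps_le_mult:
  assumes "fps_le N f g" "fps_le N f' g'" "fps_le N 0 f'" "fps_le N 0 g"
  shows "fps_le N (f * f') (g * g')"
proof -
  have "fps_le N (f' * f) (f' * g)" "fps_le N (g * f') (g * g')"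
    using assms by (auto intro: fps_le_mult_left)
  then show ?thesis
    using fps_le_trans by (simp add: mult.commute)
qed

lemma fps_le_power:
  assumes "fps_le N f g" "fps_le N 0 f"
  shows "fps_le N (f ^ k) (g ^ k)"
proof (induction k)
  case (Suc k)
  have "fps_le N 0 g" using assms fps_le_trans by blast
  then show ?case using Suc assms by (auto intro!: fps_le_mult fps_le_0_power)
qed auto

text \<open>As \<open>a\<close> has no constant term, \<open>a ^ i\<close> has no coefficients below
  degree \<open>i\<close>. Hence the sum may run to any \<open>M\<close> that is at least
  \<open>n\<close>, and one common range serves several coefficients.\<close>

lemma fps_compose_mult_nth:
  fixes a :: "real fps"
  assumes "a $ 0 = 0" "n \<le> M"
  shows "((c oo a) * d) $ n = (\<Sum>i\<le>M. c $ i * (a ^ i * d) $ n)"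
proof -
  have co: "(c oo a) $ j = (\<Sum>i\<le>M. c $ i * (a ^ i) $ j)" if "j \<le> n" for j
    unfolding fps_compose_nth
    using that assms by (intro sum.mono_neutral_left) (auto simp: startsby_zero_power_prefix[rule_format, OF assms(1)])
  have "((c oo a) * d) $ n = (\<Sum>j=0..n. (\<Sum>i\<le>M. c $ i * (a ^ i) $ j) * d $ (n - j))"
    unfolding fps_mult_nth by (intro sum.cong) (auto simp: co)
  also have "\<dots> = (\<Sum>i\<le>M. c $ i * (\<Sum>j=0..n. (a ^ i) $ j * d $ (n - j)))"
    by (subst sum_distrib_left, subst sum.swap, simp add: sum_distrib_right sum_distrib_left mult.assoc)
  finally show ?thesis by (simp add: fps_mult_nth)
qed

lemma fps_compose_nth_le:
  fixes a :: "real fps"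
  assumes "a $ 0 = 0" "n \<le> M"
  shows "(c oo a) $ n = (\<Sum>i\<le>M. c $ i * (a ^ i) $ n)"
  using fps_compose_mult_nth[OF assms, of c 1] by simp

lemma fps_le_0_compose:
  assumes "\<And>i. c $ i \<ge> 0" "fps_le N 0 a"
  shows "fps_le N 0 (c oo a)"
  using assms fps_le_0_power[OF assms(2)]
  unfolding fps_le_def fps_compose_nth by (auto intro!: sum_nonneg mult_nonneg_nonneg)

text \<open>Factor out \<open>a - b\<close>: each of the \<open>Suc i\<close> remaining products
  \<open>a ^ p * b ^ (i - p)\<close> lies between \<open>b ^ i\<close> and
  \<open>a ^ i\<close>.\<close>

lemma fps_le_power_diff:
  fixes a b :: "real fps"
  assumes "fps_le N 0 b" "fps_le N b a"
  shows "fps_le N (of_nat (Suc i) * (b ^ i * (a - b))) (a ^ Suc i - b ^ Suc i)"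
    and "fps_le N (a ^ Suc i - b ^ Suc i) (of_nat (Suc i) * (a ^ i * (a - b)))"
proof -
  have a: "fps_le N 0 a" using assms fps_le_trans by blast
  have d: "fps_le N 0 (a - b)" using assms fps_le_diff_iff by blast
  have eq: "a ^ Suc i - b ^ Suc i = (\<Sum>p<Suc i. (a - b) * (a ^ p * b ^ (i - p)))"
    by (simp only: power_diff_sumr2 sum_distrib_left) (auto intro!: sum.cong simp: algebra_simps)
  have le1: "fps_le N (a ^ p * b ^ (i - p)) (a ^ i)" if "p < Suc i" for p
  proof -
    have "fps_le N (a ^ p * b ^ (i - p)) (a ^ p * a ^ (i - p))"
      using assms a by (auto intro!: fps_le_mult_left fps_le_power fps_le_0_power)
    then show ?thesis using that by (simp add: power_add[symmetric])
  qed
  have le2: "fps_le N (b ^ i) (a ^ p * b ^ (i - p))" if "p < Suc i" for p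
  proof -
    have "fps_le N (b ^ p * b ^ (i - p)) (a ^ p * b ^ (i - p))"
      using assms a by (auto intro!: fps_le_mult fps_le_power fps_le_0_power)
    then show ?thesis using that by (simp add: power_add[symmetric])
  qed
  have "fps_le N (\<Sum>p<Suc i. (a - b) * b ^ i) (\<Sum>p<Suc i. (a - b) * (a ^ p * b ^ (i - p)))"
    using le2 d by (intro fps_le_sum fps_le_mult_left) auto
  then show "fps_le N (of_nat (Suc i) * (b ^ i * (a - b))) (a ^ Suc i - b ^ Suc i)"
    unfolding eq by (simp only: sum_constant card_lessThan mult.commute)
  have "fps_le N (\<Sum>p<Suc i. (a - b) * (a ^ p * b ^ (i - p))) (\<Sum>p<Suc i. (a - b) * a ^ i)"
    using le1 d by (intro fps_le_sum fps_le_mult_left) auto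
  then show "fps_le N (a ^ Suc i - b ^ Suc i) (of_nat (Suc i) * (a ^ i * (a - b)))"
    unfolding eq by (simp only: sum_constant card_lessThan mult.commute)
qed

text \<open>A coefficientwise mean value theorem for series with nonnegative coefficients, obtained
  term by term from the bounds on differences of powers.\<close>

lemma fps_le_compose_diff:
  fixes a b :: "real fps"
  assumes c: "\<And>i. c $ i \<ge> 0" and "fps_le N 0 b" "fps_le N b a" and 0: "a $ 0 = 0" "b $ 0 = 0"
  shows "fps_le N ((fps_deriv c oo b) * (a - b)) ((c oo a) - (c oo b))"
    and "fps_le N ((c oo a) - (c oo b)) ((fps_deriv c oo a) * (a - b))"
proof -
  have const: "(of_nat m * f) $ n = real m * f $ n" for m n and f :: "real fps"
    using fps_mult_left_const_nth[of "real m" f n] by (simp add: fps_of_nat)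
  \<comment> \<open>The constant terms of the two compositions cancel; the shift by one matches the
    indexing of the derivative.\<close>
  have rhs: "((c oo a) - (c oo b)) $ n = (\<Sum>i\<le>n. c $ Suc i * (a ^ Suc i - b ^ Suc i) $ n)" for n
    using 0 by (simp add: fps_compose_nth_le[of _ n "Suc n"] sum.atMost_Suc_shift
        right_diff_distrib sum_subtractf del: power_Suc sum.atMost_Suc)
  have drv: "((fps_deriv c oo x) * (a - b)) $ n = (\<Sum>i\<le>n. c $ Suc i * (of_nat (Suc i) * (x ^ i * (a - b))) $ n)"
    if "x $ 0 = 0" for n x
    unfolding const using that 
    by (auto simp: fps_compose_mult_nth[of _ n n] intro!: sum.cong)
  show "fps_le N ((fps_deriv c oo b) * (a - b)) ((c oo a) - (c oo b))"
    using fps_le_power_diff(1)[OF assms(2,3)] unfolding fps_le_def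
    by (auto simp: rhs drv 0 intro!: sum_mono mult_left_mono c simp del: power_Suc of_nat_Suc fps_sub_nth)
  show "fps_le N ((c oo a) - (c oo b)) ((fps_deriv c oo a) * (a - b))"
    using fps_le_power_diff(2)[OF assms(2,3)] unfolding fps_le_def
    by (auto simp: rhs drv 0 intro!: sum_mono mult_left_mono c simp del: power_Suc of_nat_Suc fps_sub_nth)
qed

section \<open>Trees of bounded height\<close>

definition fps_geom :: "real fps" where
  "fps_geom = Abs_fps (\<lambda>_. 1)"

text \<open>The series \<open>log (1 / (1 - X))\<close>; its constant term is \<open>1 / 0 = 0\<close>.\<close>

definition fps_log :: "real fps" where
  "fps_log = Abs_fps (\<lambda>k. 1 / real k)"

lemma fps_deriv_log: "fps_deriv fps_log = fps_geom"
  by (rule fps_ext) (simp add: fps_log_def fps_geom_def)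

section \<open>Trees of bounded height and Cayley's forest formula\<close>

primrec tree_egf :: "nat \<Rightarrow> real fps" where
  "tree_egf 0 = 0"
| "tree_egf (Suc h) = fps_X * (fps_exp 1 oo tree_egf h)"

lemma tree_egf_nth_0 [simp]: "tree_egf h $ 0 = 0"
  by (cases h) auto

lemma fps_exp_compose_power:
  assumes "a $ 0 = 0"
  shows "(fps_exp 1 oo a) ^ k = fps_exp (real k) oo a"
  using assms by (simp add: fps_compose_power fps_exp_power_mult)

lemma tree_egf_Suc_power:
  "tree_egf (Suc h) ^ k = fps_X ^ k * (fps_exp (real k) oo tree_egf h)"
  by (simp add: power_mult_distrib fps_exp_compose_power)

text \<open>Cayley's count \<open>k (k + m)^(m - 1)\<close> of forests with \<open>k\<close> given
  roots and \<open>m\<close> further vertices; the quotient avoids the exponent \<open>m - 1\<close>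
  at \<open>m = 0\<close>. The height bound has no effect on \<open>m <= h\<close> further vertices.
  The induction removes the roots: their children carry a forest of the same kind.\<close>

lemma forest_nth:
  assumes "k \<ge> 1" "m \<le> h"
  shows "(fps_exp (real k) oo tree_egf h) $ m =
    real k * (real k + real m) ^ m / ((real k + real m) * fact m)"
  using assms
proof (induction h arbitrary: k m)
  case 0
  then show ?case by simp
next
  case (Suc h)
  show ?case
  proof (cases m)
    case 0
    with Suc.prems show ?thesis by simp
  next
    case m: (Suc m')
    have "(fps_exp (real k) oo tree_egf (Suc h)) $ m =
        (\<Sum>s=0..m. real k ^ s / fact s * (tree_egf (Suc h) ^ s) $ m)"
      by (simp add: fps_compose_nth del: tree_egf.simps)
    also have "\<dots> = (\<Sum>s=0..m'. real k ^ Suc s / fact (Suc s) * (tree_egf (Suc h) ^ Suc s) $ m)"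
      unfolding m by (subst sum.atLeast0_atMost_Suc_shift) (simp del: tree_egf.simps power_Suc fact_Suc)
    also have "\<dots> = (\<Sum>s=0..m'. real k / (real m * fact m') * 
        (real (m' choose s) * real k ^ s * real m ^ (m' - s)))"
    proof (intro sum.cong refl)
      fix s assume s: "s \<in> {0..m'}"
      \<comment> \<open>Degree \<open>m' - s\<close> is left for \<open>Suc s\<close> roots, so the
        base in the induction hypothesis is \<open>Suc s + (m' - s) = m\<close> for every
        \<open>s\<close>. This lets the binomial theorem sum over \<open>s\<close>.\<close>
      have "(tree_egf (Suc h) ^ Suc s) $ m = (fps_exp (real (Suc s)) oo tree_egf h) $ (m' - s)"
        unfolding tree_egf_Suc_power using s m by (simp add: fps_X_power_mult_nth del: power_Suc)
      also have "\<dots> = real (Suc s) * real m ^ (m' - s) / (real m * fact (m' - s))"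
        using s m Suc.prems by (subst Suc.IH) (auto simp: of_nat_diff)
      finally have *: "(tree_egf (Suc h) ^ Suc s) $ m = real (Suc s) * real m ^ (m' - s) / (real m * fact (m' - s))" .
      have "real (m' choose s) = fact m' / (fact s * fact (m' - s))"
        using s by (simp add: binomial_fact)
      then show "real k ^ Suc s / fact (Suc s) * (tree_egf (Suc h) ^ Suc s) $ m =
          real k / (real m * fact m') * (real (m' choose s) * real k ^ s * real m ^ (m' - s))"
        unfolding * by (simp del: of_nat_Suc)
    qed
    also have "\<dots> = real k / (real m * fact m') * (real k + real m) ^ m'"
      by (subst binomial_ring) (simp add: sum_distrib_left atLeast0AtMost)
    also have "\<dots> = real k * (real k + real m) ^ m / ((real k + real m) * fact m)"
    proof -
      have "fact m = real m * fact m'" "(real k + real m) ^ m = (real k + real m) * (real k + real m) ^ m'"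
        using m by auto
      moreover have "real k + real m > 0" using m by simp
      ultimately show ?thesis by simp
    qed
    finally show ?thesis .
  qed
qed

lemma tree_egf_power_nth:
  assumes "1 \<le> k" "k \<le> n" "n \<le> h"
  shows "(tree_egf h ^ k) $ n = real k * real n ^ (n - k) / (real n * fact (n - k))"
proof -
  obtain h' where h: "h = Suc h'" using assms by (cases h) auto
  have "(tree_egf h ^ k) $ n = (fps_exp (real k) oo tree_egf h') $ (n - k)"
    unfolding h tree_egf_Suc_power using assms by (simp add: fps_X_power_mult_nth)
  then show ?thesis using assms h by (simp add: forest_nth)
qed

section \<open>Domination of error sums by summation by parts\<close>

lemma sum_by_parts:
  fixes p d :: "nat \<Rightarrow> 'a::comm_ring_1"
  shows "(\<Sum>h<N. p (Suc h) * (d h - d (Suc h))) =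
    p 0 * d 0 - p N * d N + (\<Sum>h<N. d h * (p (Suc h) - p h))"
  by (induction N) (auto simp: algebra_simps)

text \<open>Trees of height exactly \<open>h\<close>, since \<open>tree_egf h\<close> counts those
  of height less than \<open>h\<close>.\<close>

definition height_egf :: "nat \<Rightarrow> real fps" where
  "height_egf h = tree_egf (Suc h) - tree_egf h"

text \<open>Mappings all of whose trees have height less than \<open>h\<close>: the
  \<open>k!\<close> permutations of \<open>k\<close> cyclic vertices cancel the
  \<open>1 / k!\<close> of a set of \<open>k\<close> trees.\<close>

definition seq_egf :: "nat \<Rightarrow> real fps" where
  "seq_egf h = fps_geom oo tree_egf h"

lemma seq_egf_eq: "(1 - tree_egf h) * seq_egf h = 1"
proof -
  have "(1 - fps_X) * fps_geom = 1"
    by (rule fps_ext) (simp add: fps_geom_def algebra_simps)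
  then have "((1 - fps_X) * fps_geom) oo tree_egf h = 1 oo tree_egf h"
    by simp
  then show ?thesis
    by (simp add: fps_compose_mult_distrib fps_compose_sub_distrib seq_egf_def)
qed

lemma seq_egf_0 [simp]: "seq_egf 0 = 1"
  using seq_egf_eq[of 0] by simp

lemma seq_egf_diff:
  "seq_egf (Suc h) - seq_egf h = height_egf h * seq_egf h * seq_egf (Suc h)"
proof -
  have "seq_egf (Suc h) - seq_egf h =
      ((1 - tree_egf h) * seq_egf h) * seq_egf (Suc h) -
      ((1 - tree_egf (Suc h)) * seq_egf (Suc h)) * seq_egf h"
    unfolding seq_egf_eq by simp
  also have "\<dots> = height_egf h * seq_egf h * seq_egf (Suc h)"
    by (simp add: height_egf_def algebra_simps del: tree_egf.simps)
  finally show ?thesis .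
qed

lemma fps_le_compose_mono:
  fixes a b :: "real fps"
  assumes c: "\<And>i. c $ i \<ge> 0" and ab: "fps_le N 0 b" "fps_le N b a" and 0: "a $ 0 = 0" "b $ 0 = 0"
  shows "fps_le N (c oo b) (c oo a)"
proof -
  have "fps_le N 0 ((fps_deriv c oo b) * (a - b))"
    using ab c by (intro fps_le_0_mult fps_le_0_compose) (auto simp: fps_le_diff_iff[symmetric])
  also note fps_le_compose_diff(1)[OF assms]
  finally show ?thesis by (simp add: fps_le_diff_iff[symmetric])
qed

lemma tree_egf_nonneg [simp]: "fps_le N 0 (tree_egf h)"
  by (induction h) (auto intro!: fps_le_0_mult fps_le_0_compose)

lemma tree_egf_mono_Suc: "fps_le N (tree_egf h) (tree_egf (Suc h))"
proof (induction h)
  case (Suc h)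
  have "fps_le N (fps_exp 1 oo tree_egf h) (fps_exp 1 oo tree_egf (Suc h))"
    using Suc by (intro fps_le_compose_mono) (auto simp del: tree_egf.simps(2))
  then show ?case
    by (subst (1 2) tree_egf.simps(2)) (auto intro!: fps_le_mult_left simp del: tree_egf.simps(2))
qed auto

lemma tree_egf_mono: "h \<le> h' \<Longrightarrow> fps_le N (tree_egf h) (tree_egf h')"
  by (induction h' rule: dec_induct) (auto intro: fps_le_trans tree_egf_mono_Suc simp del: tree_egf.simps)

lemma height_egf_nonneg [simp]: "fps_le N 0 (height_egf h)"
  using tree_egf_mono_Suc fps_le_diff_iff unfolding height_egf_def by blast

lemma seq_egf_nonneg [simp]: "fps_le N 0 (seq_egf h)"
  unfolding seq_egf_def by (intro fps_le_0_compose) (auto simp: fps_geom_def)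

lemma one_le_seq_egf: "fps_le N 1 (seq_egf h)"
proof -
  have eq: "seq_egf h - 1 = tree_egf h * seq_egf h"
    using seq_egf_eq[of h] by (simp add: algebra_simps)
  have "fps_le N 0 (seq_egf h - 1)"
    unfolding eq by (intro fps_le_0_mult) auto
  then show ?thesis
    by (simp add: fps_le_diff_iff[symmetric])
qed

lemma height_egf_Suc:
  "height_egf (Suc h) = fps_X * ((fps_exp 1 oo tree_egf (Suc h)) - (fps_exp 1 oo tree_egf h))"
  by (simp add: height_egf_def algebra_simps)

text \<open>The mean value bounds for \<open>fps_exp 1\<close>, which is its own derivative;
  multiplication by \<open>fps_X\<close> turns \<open>fps_exp 1 oo tree_egf h\<close> into
  \<open>tree_egf (Suc h)\<close>.\<close>

lemma height_egf_Suc_bounds: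
  shows "fps_le N (tree_egf (Suc h) * height_egf h) (height_egf (Suc h))"
    and "fps_le N (height_egf (Suc h)) (tree_egf (Suc (Suc h)) * height_egf h)"
proof -
  have "fps_le N (fps_X * ((fps_exp 1 oo tree_egf h) * (tree_egf (Suc h) - tree_egf h)))
          (fps_X * ((fps_exp 1 oo tree_egf (Suc h)) - (fps_exp 1 oo tree_egf h)))"
    using fps_le_compose_diff(1)[of "fps_exp 1" N "tree_egf h" "tree_egf (Suc h)"] tree_egf_mono_Suc
    by (intro fps_le_mult_left) (auto simp del: tree_egf.simps(2))
  then show "fps_le N (tree_egf (Suc h) * height_egf h) (height_egf (Suc h))"
    unfolding height_egf_Suc by (simp add: height_egf_def mult.assoc)
  have "fps_le N (fps_X * ((fps_exp 1 oo tree_egf (Suc h)) - (fps_exp 1 oo tree_egf h)))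
      (fps_X * ((fps_exp 1 oo tree_egf (Suc h)) * (tree_egf (Suc h) - tree_egf h)))"
    using fps_le_compose_diff(2)[of "fps_exp 1" N "tree_egf h" "tree_egf (Suc h)"] tree_egf_mono_Suc
    by (intro fps_le_mult_left) (auto simp del: tree_egf.simps(2))
  then show "fps_le N (height_egf (Suc h)) (tree_egf (Suc (Suc h)) * height_egf h)"
    unfolding height_egf_Suc
    by (subst tree_egf.simps(2)) (simp add: height_egf_def mult.assoc del: tree_egf.simps(2))
qed

text \<open>A tree of height \<open>h\<close> has more than \<open>h\<close> vertices.
  Algebraically, each step from \<open>h\<close> to \<open>Suc h\<close> multiplies by at most a
  series without constant term, and the coefficients are nonnegative.\<close>

lemma height_egf_nth_eq_0: "i \<le> h \<Longrightarrow> height_egf h $ i = 0"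
proof (induction h arbitrary: i)
  case 0
  then show ?case by (simp add: height_egf_def)
next
  case (Suc h)
  have "(tree_egf (Suc (Suc h)) * height_egf h) $ i = 0"
    unfolding fps_mult_nth
  proof (intro sum.neutral ballI)
    fix j assume "j \<in> {0..i}"
    then show "tree_egf (Suc (Suc h)) $ j * height_egf h $ (i - j) = 0"
      using Suc.prems by (cases "j = 0") (auto simp: Suc.IH simp del: tree_egf.simps(2))
  qed
  then have "height_egf (Suc h) $ i \<le> 0"
    using fps_le_nth[OF height_egf_Suc_bounds(2)[of i h], of i] by simp
  moreover have "height_egf (Suc h) $ i \<ge> 0"
    using fps_le_nth[OF height_egf_nonneg, of i i "Suc h"] by simp
  ultimately show ?case by simp
qed

lemma height_egf_mult_nth_eq_0: "i \<le> N \<Longrightarrow> (f * height_egf N) $ i = 0"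
  unfolding fps_mult_nth by (intro sum.neutral) (auto simp: height_egf_nth_eq_0)

text \<open>The boundary term at \<open>0\<close> is nonnegative and may be dropped; the one at
  \<open>N\<close> contains \<open>height_egf N\<close>, which has no coefficients up to degree
  \<open>N\<close>. This is why the number of summands and the degree of comparison are the same
  \<open>N\<close>.\<close>

lemma fps_le_by_parts:
  assumes p: "\<And>h. fps_le N 0 (p h)" and j: "j \<ge> 1"
  shows "fps_le N (\<Sum>h<N. height_egf h ^ j * (p (Suc h) - p h))
           (\<Sum>h<N. p (Suc h) * (height_egf h ^ j - height_egf (Suc h) ^ j))"
proof -
  obtain j' where j': "j = Suc j'" using j by (cases j) auto
  have "fps_le N 0 (p 0 * height_egf 0 ^ j)"
    by (intro fps_le_0_mult fps_le_0_power p) auto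
  moreover have "(p N * height_egf N ^ j) $ i = 0" if "i \<le> N" for i
    using height_egf_mult_nth_eq_0[OF that, of "p N * height_egf N ^ j'"] by (simp add: j' mult_ac)
  ultimately show ?thesis
    unfolding sum_by_parts[of p "\<lambda>h. height_egf h ^ j" N] fps_le_def by simp
qed

lemma sum_height_egf: "(\<Sum>h<N. height_egf h) = tree_egf N"
  using sum_lessThan_telescope[of tree_egf N] by (simp add: height_egf_def)

text \<open>Since \<open>D_h U_h U_{h+1}\<close> is the increment of \<open>U\<close>, summation by
  parts moves the difference to \<open>D\<close>. Then
  \<open>D_h - D_{h+1} <= (1 - A_{h+1}) D_h\<close> cancels \<open>U_{h+1}\<close>, and what remains
  telescopes.\<close>

lemma sum_height_sq_seq_seq_le:
  "fps_le N (\<Sum>h<N. height_egf h ^ 2 * seq_egf h * seq_egf (Suc h)) (tree_egf N)"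
proof -
  have "(\<Sum>h<N. height_egf h ^ 2 * seq_egf h * seq_egf (Suc h)) =
      (\<Sum>h<N. height_egf h ^ 1 * (seq_egf (Suc h) - seq_egf h))"
    unfolding seq_egf_diff by (simp add: power2_eq_square mult_ac)
  also have "fps_le N \<dots> (\<Sum>h<N. seq_egf (Suc h) * (height_egf h ^ 1 - height_egf (Suc h) ^ 1))"
    by (rule fps_le_by_parts) auto
  also have "fps_le N \<dots> (\<Sum>h<N. height_egf h)"
  proof (rule fps_le_sum)
    fix h
    have "fps_le N (seq_egf (Suc h) * (height_egf h - height_egf (Suc h)))
        (seq_egf (Suc h) * (height_egf h - tree_egf (Suc h) * height_egf h))"
      by (intro fps_le_mult_left fps_le_diff_left height_egf_Suc_bounds(1) seq_egf_nonneg)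
    also have "seq_egf (Suc h) * (height_egf h - tree_egf (Suc h) * height_egf h) =
        ((1 - tree_egf (Suc h)) * seq_egf (Suc h)) * height_egf h"
      by (simp add: algebra_simps del: tree_egf.simps)
    also have "\<dots> = height_egf h"
      unfolding seq_egf_eq by simp
    finally show "fps_le N (seq_egf (Suc h) * (height_egf h ^ 1 - height_egf (Suc h) ^ 1)) (height_egf h)"
      by simp
  qed
  finally show ?thesis by (simp add: sum_height_egf)
qed

text \<open>Here \<open>D_h^2 - D_{h+1}^2 <= (1 - A_{h+1}) (1 + A_{h+1}) D_h^2\<close>. The first
  factor cancels one \<open>U_{h+1}\<close>, the second is at most \<open>1 + A_N\<close>.\<close>

lemma fps_le_by_parts_squares:
  assumes p: "\<And>h. fps_le N 0 (p h)"
  shows "fps_le N (\<Sum>h<N. height_egf h ^ 2 * (seq_egf (Suc h) * p (Suc h) - seq_egf h * p h))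
           ((1 + tree_egf N) * (\<Sum>h<N. height_egf h ^ 2 * p (Suc h)))"
proof -
  let ?q = "\<lambda>h. seq_egf h * p h"
  have "fps_le N (\<Sum>h<N. height_egf h ^ 2 * (?q (Suc h) - ?q h))
          (\<Sum>h<N. ?q (Suc h) * (height_egf h ^ 2 - height_egf (Suc h) ^ 2))"
    by (rule fps_le_by_parts) (auto intro!: fps_le_0_mult p)
  also have "fps_le N \<dots> (\<Sum>h<N. (1 + tree_egf N) * (height_egf h ^ 2 * p (Suc h)))"
  proof (rule fps_le_sum)
    fix h assume h: "h \<in> {..<N}"
    have "fps_le N ((tree_egf (Suc h) * height_egf h) ^ 2) (height_egf (Suc h) ^ 2)"
      by (rule fps_le_power[OF height_egf_Suc_bounds(1)]) (intro fps_le_0_mult tree_egf_nonneg height_egf_nonneg)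
    then have "fps_le N (?q (Suc h) * (height_egf h ^ 2 - height_egf (Suc h) ^ 2))
        (?q (Suc h) * (height_egf h ^ 2 - (tree_egf (Suc h) * height_egf h) ^ 2))"
      by (intro fps_le_mult_left fps_le_diff_left fps_le_0_mult p seq_egf_nonneg)
    also have "?q (Suc h) * (height_egf h ^ 2 - (tree_egf (Suc h) * height_egf h) ^ 2) =
        ((1 - tree_egf (Suc h)) * seq_egf (Suc h)) * ((1 + tree_egf (Suc h)) * (height_egf h ^ 2 * p (Suc h)))"
      by (simp add: algebra_simps power2_eq_square del: tree_egf.simps)
    also have "\<dots> = (1 + tree_egf (Suc h)) * (height_egf h ^ 2 * p (Suc h))"
      unfolding seq_egf_eq by simp
    also have "fps_le N \<dots> ((1 + tree_egf N) * (height_egf h ^ 2 * p (Suc h)))"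
      using h by (intro fps_le_mult fps_le_add fps_le_0_mult fps_le_0_power fps_le_0_add p tree_egf_mono)
        (auto simp del: tree_egf.simps)
    finally show "fps_le N (?q (Suc h) * (height_egf h ^ 2 - height_egf (Suc h) ^ 2)) \<dots>" .
  qed
  finally show ?thesis by (simp add: sum_distrib_left)
qed

text \<open>Write \<open>U_{h+1}^2 = U_h U_{h+1} + U_{h+1} (U_{h+1} - U_h)\<close>. The first part
  is bounded already. The second yields \<open>D_h^3 U_h U_{h+1}^2\<close>, one of two nonnegative
  parts of \<open>D_h^2 (U_{h+1}^2 - U_h^2)\<close>, which summation by parts reduces to the first
  kind.\<close>

lemma sum_height_sq_seq_sq_le:
  "fps_le N (\<Sum>h<N. height_egf h ^ 2 * seq_egf (Suc h) ^ 2) (2 * tree_egf N + tree_egf N ^ 2)"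
proof -
  let ?S = "\<Sum>h<N. height_egf h ^ 2 * seq_egf h * seq_egf (Suc h)"
  have "fps_le N (\<Sum>h<N. height_egf h ^ 3 * seq_egf h * seq_egf (Suc h) ^ 2)
      (\<Sum>h<N. height_egf h ^ 2 * (seq_egf (Suc h) * seq_egf (Suc h) - seq_egf h * seq_egf h))"
  proof (rule fps_le_sum)
    fix h
    have "height_egf h ^ 2 * (seq_egf (Suc h) * seq_egf (Suc h) - seq_egf h * seq_egf h) =
        height_egf h ^ 2 * (seq_egf (Suc h) + seq_egf h) * (seq_egf (Suc h) - seq_egf h)"
      by (simp add: algebra_simps)
    also have "\<dots> = height_egf h ^ 3 * seq_egf h * seq_egf (Suc h) ^ 2 +
        height_egf h ^ 3 * seq_egf h ^ 2 * seq_egf (Suc h)"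
      unfolding seq_egf_diff by (simp add: algebra_simps power2_eq_square power3_eq_cube)
    finally have eq: "height_egf h ^ 2 * (seq_egf (Suc h) * seq_egf (Suc h) - seq_egf h * seq_egf h) = \<dots>" .
    show "fps_le N (height_egf h ^ 3 * seq_egf h * seq_egf (Suc h) ^ 2)
       (height_egf h ^ 2 * (seq_egf (Suc h) * seq_egf (Suc h) - seq_egf h * seq_egf h))"
      unfolding eq by (subst fps_le_diff_iff) (auto intro!: fps_le_0_mult fps_le_0_power)
  qed
  also have "fps_le N \<dots> ((1 + tree_egf N) * (\<Sum>h<N. height_egf h ^ 2 * seq_egf (Suc h)))"
    by (rule fps_le_by_parts_squares) auto
  \<comment> \<open>Inserting the factor \<open>seq_egf h\<close>, which dominates \<open>1\<close>,
    leads back to the sum bounded before.\<close>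
  also have "fps_le N \<dots> ((1 + tree_egf N) * ?S)"
  proof (intro fps_le_mult_left fps_le_sum fps_le_0_add)
    fix h
    have "fps_le N (height_egf h ^ 2 * seq_egf (Suc h) * 1) (height_egf h ^ 2 * seq_egf (Suc h) * seq_egf h)"
      by (intro fps_le_mult_left one_le_seq_egf fps_le_0_mult fps_le_0_power) auto
    then show "fps_le N (height_egf h ^ 2 * seq_egf (Suc h)) (height_egf h ^ 2 * seq_egf h * seq_egf (Suc h))"
      by (simp add: mult_ac)
  qed auto
  also have "fps_le N \<dots> ((1 + tree_egf N) * tree_egf N)"
    by (intro fps_le_mult_left sum_height_sq_seq_seq_le fps_le_0_add) auto
  finally have "fps_le N (?S + (\<Sum>h<N. height_egf h ^ 3 * seq_egf h * seq_egf (Suc h) ^ 2))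
      (tree_egf N + (1 + tree_egf N) * tree_egf N)"
    by (intro fps_le_add sum_height_sq_seq_seq_le)
  also have "?S + (\<Sum>h<N. height_egf h ^ 3 * seq_egf h * seq_egf (Suc h) ^ 2) =
      (\<Sum>h<N. height_egf h ^ 2 * seq_egf (Suc h) ^ 2)"
    unfolding sum.distrib[symmetric]
  proof (rule sum.cong[OF refl])
    fix h
    have "height_egf h ^ 2 * seq_egf (Suc h) ^ 2 = height_egf h ^ 2 * seq_egf h * seq_egf (Suc h) +
        height_egf h ^ 2 * seq_egf (Suc h) * (seq_egf (Suc h) - seq_egf h)"
      by (simp add: algebra_simps power2_eq_square)
    then show "height_egf h ^ 2 * seq_egf h * seq_egf (Suc h) + height_egf h ^ 3 * seq_egf h * seq_egf (Suc h) ^ 2 =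
        height_egf h ^ 2 * seq_egf (Suc h) ^ 2"
      unfolding seq_egf_diff by (simp add: algebra_simps power2_eq_square power3_eq_cube)
  qed
  finally show ?thesis by (simp add: algebra_simps power2_eq_square)
qed

text \<open>The same device one power higher: the summand is the middle one of three nonnegative
  parts of \<open>D_h^2 (U_{h+1}^3 - U_h^3)\<close>.\<close>

lemma sum_height_cube_le:
  "fps_le N (\<Sum>h<N. height_egf h ^ 3 * seq_egf h ^ 2 * seq_egf (Suc h) ^ 2)
     ((1 + tree_egf N) * (2 * tree_egf N + tree_egf N ^ 2))"
proof -
  have "fps_le N (\<Sum>h<N. height_egf h ^ 3 * seq_egf h ^ 2 * seq_egf (Suc h) ^ 2)
      (\<Sum>h<N. height_egf h ^ 2 * (seq_egf (Suc h) * seq_egf (Suc h) ^ 2 - seq_egf h * seq_egf h ^ 2))"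
  proof (rule fps_le_sum)
    fix h
    have "height_egf h ^ 2 * (seq_egf (Suc h) * seq_egf (Suc h) ^ 2 - seq_egf h * seq_egf h ^ 2) =
        height_egf h ^ 2 * (seq_egf (Suc h) ^ 2 + seq_egf (Suc h) * seq_egf h + seq_egf h ^ 2) *
          (seq_egf (Suc h) - seq_egf h)"
      by (simp add: algebra_simps power2_eq_square)
    also have "\<dots> = height_egf h ^ 3 * seq_egf h ^ 2 * seq_egf (Suc h) ^ 2 +
        height_egf h ^ 3 * (seq_egf h * seq_egf (Suc h) ^ 3 + seq_egf h ^ 3 * seq_egf (Suc h))"
      unfolding seq_egf_diff by (simp add: algebra_simps power2_eq_square power3_eq_cube)
    finally have eq: "height_egf h ^ 2 * (seq_egf (Suc h) * seq_egf (Suc h) ^ 2 - seq_egf h * seq_egf h ^ 2) = \<dots>" .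
    show "fps_le N (height_egf h ^ 3 * seq_egf h ^ 2 * seq_egf (Suc h) ^ 2)
       (height_egf h ^ 2 * (seq_egf (Suc h) * seq_egf (Suc h) ^ 2 - seq_egf h * seq_egf h ^ 2))"
      unfolding eq by (subst fps_le_diff_iff) (auto intro!: fps_le_0_mult fps_le_0_power fps_le_0_add)
  qed
  also have "fps_le N \<dots> ((1 + tree_egf N) * (\<Sum>h<N. height_egf h ^ 2 * seq_egf (Suc h) ^ 2))"
    by (rule fps_le_by_parts_squares) (auto intro!: fps_le_0_power)
  also have "fps_le N \<dots> ((1 + tree_egf N) * (2 * tree_egf N + tree_egf N ^ 2))"
    by (intro fps_le_mult_left sum_height_sq_seq_sq_le fps_le_0_add) auto
  finally show ?thesis .
qed

text \<open>\<open>E\<close> collects the error of the approximation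
  \<open>D_{h+1} = A_{h+1} D_h\<close>. By the two mean value bounds this error lies between
  \<open>0\<close> and \<open>(A_{h+2} - A_{h+1}) D_h = D_{h+1} D_h\<close>, which is of second
  order: at most \<open>A_{N+1} D_h^2\<close>.\<close>

lemma sum_height_defect_bounds:
  fixes N :: nat
  defines "E \<equiv> (\<Sum>h<N. seq_egf (Suc h) ^ 2 * (height_egf (Suc h) - tree_egf (Suc h) * height_egf h))"
  shows "fps_le N 0 E" "fps_le N E (tree_egf (Suc N) * (2 * tree_egf N + tree_egf N ^ 2))"
proof -
  show "fps_le N 0 E"
    unfolding E_def using height_egf_Suc_bounds(1)
    by (intro fps_le_0_sum fps_le_0_mult fps_le_0_power) (auto simp: fps_le_diff_iff[symmetric] simp del: tree_egf.simps)
  have "fps_le N E (\<Sum>h<N. tree_egf (Suc N) * (height_egf h ^ 2 * seq_egf (Suc h) ^ 2))"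
    unfolding E_def
  proof (rule fps_le_sum)
    fix h assume h: "h \<in> {..<N}"
    have "fps_le N (height_egf (Suc h)) (tree_egf (Suc (Suc h)) * height_egf h)"
      by (rule height_egf_Suc_bounds)
    then have "fps_le N (height_egf (Suc h) - tree_egf (Suc h) * height_egf h)
        (tree_egf (Suc (Suc h)) * height_egf h - tree_egf (Suc h) * height_egf h)"
      by (simp add: fps_le_def)
    also have "tree_egf (Suc (Suc h)) * height_egf h - tree_egf (Suc h) * height_egf h =
        height_egf h * height_egf (Suc h)"
      by (simp add: height_egf_def algebra_simps del: tree_egf.simps)
    also have "fps_le N \<dots> (height_egf h * (tree_egf (Suc (Suc h)) * height_egf h))"
      by (intro fps_le_mult_left height_egf_Suc_bounds) auto
    also have "fps_le N \<dots> (height_egf h * (tree_egf (Suc N) * height_egf h))"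
      using h by (intro fps_le_mult_left fps_le_mult tree_egf_mono fps_le_0_mult) 
        (auto simp del: tree_egf.simps)
    finally have "fps_le N (seq_egf (Suc h) ^ 2 * (height_egf (Suc h) - tree_egf (Suc h) * height_egf h))
        (seq_egf (Suc h) ^ 2 * (height_egf h * (tree_egf (Suc N) * height_egf h)))"
      by (intro fps_le_mult_left fps_le_0_power) auto
    then show "fps_le N (seq_egf (Suc h) ^ 2 * (height_egf (Suc h) - tree_egf (Suc h) * height_egf h))
        (tree_egf (Suc N) * (height_egf h ^ 2 * seq_egf (Suc h) ^ 2))"
      by (simp add: algebra_simps power2_eq_square del: tree_egf.simps)
  qed
  also have "fps_le N \<dots> (tree_egf (Suc N) * (2 * tree_egf N + tree_egf N ^ 2))"
    unfolding sum_distrib_left[symmetric]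
    by (intro fps_le_mult_left sum_height_sq_seq_sq_le tree_egf_nonneg)
  finally show "fps_le N E (tree_egf (Suc N) * (2 * tree_egf N + tree_egf N ^ 2))" .
qed

text \<open>The highest tree, of height \<open>h\<close>, may sit at any of the \<open>k\<close>
  cyclic vertices, and the sum of \<open>k D_h A_h^(k-1)\<close> over \<open>k\<close> is
  \<open>D_h U_h^2\<close>. Heights from \<open>N\<close> on contribute nothing up to degree
  \<open>N\<close>.\<close>

definition unique_egf :: "nat \<Rightarrow> real fps" where
  "unique_egf N = (\<Sum>h<N. height_egf h * seq_egf h ^ 2)"

text \<open>Up to degree \<open>N\<close>, \<open>seq_egf N\<close> counts all mappings, and
  \<open>1\<close> is the empty one; so this is the series of mappings without a unique highest
  tree. The increments of \<open>U\<close> telescope, and the identity for them is applied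
  twice.\<close>

lemma seq_egf_minus_unique_egf:
  "seq_egf N - 1 - unique_egf N = (\<Sum>h<N. height_egf h ^ 2 * seq_egf h ^ 2 * seq_egf (Suc h))"
proof -
  have "seq_egf N - 1 = (\<Sum>h<N. seq_egf (Suc h) - seq_egf h)"
    using sum_lessThan_telescope[of seq_egf N] by simp
  then have "seq_egf N - 1 - unique_egf N =
      (\<Sum>h<N. (seq_egf (Suc h) - seq_egf h) - height_egf h * seq_egf h ^ 2)"
    by (simp add: unique_egf_def sum_subtractf)
  also have "\<dots> = (\<Sum>h<N. height_egf h * seq_egf h * (seq_egf (Suc h) - seq_egf h))"
    by (intro sum.cong refl, subst seq_egf_diff) (simp add: algebra_simps power2_eq_square)
  also have "\<dots> = (\<Sum>h<N. height_egf h ^ 2 * seq_egf h ^ 2 * seq_egf (Suc h))"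
    by (intro sum.cong refl) (simp add: seq_egf_diff algebra_simps power2_eq_square)
  finally show ?thesis .
qed

text \<open>By the mean value bounds, each increment of the logarithm lies between
  \<open>U_h D_h\<close> and \<open>U_{h+1} D_h\<close>. In total these differ by the sum of
  \<open>D_h^2 U_h U_{h+1}\<close>, which is at most \<open>tree_egf N\<close>.\<close>

lemma log_egf_bounds:
  shows "fps_le N (fps_log oo tree_egf N) (\<Sum>h<N. seq_egf (Suc h) * height_egf h)"
    and "fps_le N (\<Sum>h<N. seq_egf (Suc h) * height_egf h) ((fps_log oo tree_egf N) + tree_egf N)"
proof -
  let ?L = "\<lambda>h. fps_log oo tree_egf h"
  have L: "?L N = (\<Sum>h<N. ?L (Suc h) - ?L h)"
    using sum_lessThan_telescope[of ?L N] by (simp add: fps_log_def del: tree_egf.simps(2))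
  have nonneg: "fps_log $ i \<ge> 0" for i
    by (simp add: fps_log_def)
  have up: "fps_le N (?L (Suc h) - ?L h) (seq_egf (Suc h) * height_egf h)" for h
    using fps_le_compose_diff(2)[OF nonneg tree_egf_nonneg tree_egf_mono_Suc tree_egf_nth_0 tree_egf_nth_0]
    by (simp add: fps_deriv_log seq_egf_def height_egf_def del: tree_egf.simps(2))
  have low: "fps_le N (seq_egf h * height_egf h) (?L (Suc h) - ?L h)" for h
    using fps_le_compose_diff(1)[OF nonneg tree_egf_nonneg tree_egf_mono_Suc tree_egf_nth_0 tree_egf_nth_0]
    by (simp add: fps_deriv_log seq_egf_def height_egf_def del: tree_egf.simps(2))
  show "fps_le N (?L N) (\<Sum>h<N. seq_egf (Suc h) * height_egf h)"
    unfolding L by (intro fps_le_sum up)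
  have "(\<Sum>h<N. seq_egf (Suc h) * height_egf h) = (\<Sum>h<N. seq_egf h * height_egf h) +
      (\<Sum>h<N. height_egf h * (seq_egf (Suc h) - seq_egf h))"
    by (simp add: sum.distrib[symmetric] algebra_simps)
  also have "(\<Sum>h<N. height_egf h * (seq_egf (Suc h) - seq_egf h)) =
      (\<Sum>h<N. height_egf h ^ 2 * seq_egf h * seq_egf (Suc h))"
    by (intro sum.cong refl) (simp add: seq_egf_diff power2_eq_square)
  also have "fps_le N ((\<Sum>h<N. seq_egf h * height_egf h) + \<dots>) (?L N + tree_egf N)"
    unfolding L by (intro fps_le_add fps_le_sum low sum_height_sq_seq_seq_le)
  finally show "fps_le N (\<Sum>h<N. seq_egf (Suc h) * height_egf h) (?L N + tree_egf N)" .
qed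

text \<open>The sum of \<open>U_{h+1}^2 (D_h - D_{h+1})\<close> in two ways: replacing
  \<open>D_{h+1}\<close> by \<open>A_{h+1} D_h\<close> plus a defect cancels one
  \<open>U_{h+1}\<close>; summation by parts gives differences of \<open>U^2\<close>, that is, twice
  the wanted term and a term cubic in \<open>D\<close>. The summand \<open>fps_X\<close> is the
  boundary term at \<open>0\<close>.\<close>

lemma non_unique_egf_eq:
  "2 * (\<Sum>h<N. height_egf h ^ 2 * seq_egf h ^ 2 * seq_egf (Suc h)) =
   (\<Sum>h<N. seq_egf (Suc h) * height_egf h)
   - (\<Sum>h<N. seq_egf (Suc h) ^ 2 * (height_egf (Suc h) - tree_egf (Suc h) * height_egf h))
   - (\<Sum>h<N. height_egf h ^ 3 * seq_egf h ^ 2 * seq_egf (Suc h) ^ 2)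
   - fps_X + seq_egf N ^ 2 * height_egf N"
proof -
  have "(\<Sum>h<N. seq_egf (Suc h) ^ 2 * (height_egf h - height_egf (Suc h))) =
      seq_egf 0 ^ 2 * height_egf 0 - seq_egf N ^ 2 * height_egf N +
      (\<Sum>h<N. height_egf h * (seq_egf (Suc h) ^ 2 - seq_egf h ^ 2))"
    by (rule sum_by_parts)
  moreover have "height_egf 0 = fps_X"
    by (simp add: height_egf_def)
  moreover have "(\<Sum>h<N. seq_egf (Suc h) ^ 2 * (height_egf h - height_egf (Suc h))) =
     (\<Sum>h<N. seq_egf (Suc h) * height_egf h)
   - (\<Sum>h<N. seq_egf (Suc h) ^ 2 * (height_egf (Suc h) - tree_egf (Suc h) * height_egf h))"
    unfolding sum_subtractf[symmetric]
  proof (intro sum.cong refl)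
    fix h
    have "seq_egf (Suc h) ^ 2 * (height_egf h - height_egf (Suc h)) =
        ((1 - tree_egf (Suc h)) * seq_egf (Suc h)) * (seq_egf (Suc h) * height_egf h) -
        seq_egf (Suc h) ^ 2 * (height_egf (Suc h) - tree_egf (Suc h) * height_egf h)"
      by (simp add: algebra_simps power2_eq_square del: tree_egf.simps)
    then show "seq_egf (Suc h) ^ 2 * (height_egf h - height_egf (Suc h)) =
        seq_egf (Suc h) * height_egf h -
        seq_egf (Suc h) ^ 2 * (height_egf (Suc h) - tree_egf (Suc h) * height_egf h)"
      unfolding seq_egf_eq by simp
  qed
  moreover have "(\<Sum>h<N. height_egf h * (seq_egf (Suc h) ^ 2 - seq_egf h ^ 2)) =
      2 * (\<Sum>h<N. height_egf h ^ 2 * seq_egf h ^ 2 * seq_egf (Suc h)) +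
      (\<Sum>h<N. height_egf h ^ 3 * seq_egf h ^ 2 * seq_egf (Suc h) ^ 2)"
    unfolding sum_distrib_left sum.distrib[symmetric]
  proof (intro sum.cong refl)
    fix h
    have "height_egf h * (seq_egf (Suc h) ^ 2 - seq_egf h ^ 2) =
        height_egf h * (2 * seq_egf h + (seq_egf (Suc h) - seq_egf h)) * (seq_egf (Suc h) - seq_egf h)"
      by (simp add: algebra_simps power2_eq_square)
    also have "\<dots> = 2 * (height_egf h ^ 2 * seq_egf h ^ 2 * seq_egf (Suc h)) +
        height_egf h ^ 3 * seq_egf h ^ 2 * seq_egf (Suc h) ^ 2"
      unfolding seq_egf_diff by (simp add: algebra_simps power2_eq_square power3_eq_cube)
    finally show "height_egf h * (seq_egf (Suc h) ^ 2 - seq_egf h ^ 2) = \<dots>" .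
  qed
  \<comment> \<open>Solving for the wanted sum, stated for variables so that the sums stay opaque;
    \<open>1\<^sup>2 * x\<close> stands for \<open>seq_egf 0 ^ 2 * height_egf 0\<close>.\<close>
  moreover have "d = s - e - f - x + b" if "s - e = 1\<^sup>2 * x - b + (d + f)" for s e x b d f :: "real fps"
    using that by (simp add: algebra_simps)
  ultimately show ?thesis
    by (simp only: seq_egf_0)
qed

section \<open>Coefficients of the generating functions\<close>

lemma tree_egf_power_nth_le:
  assumes "1 \<le> k" "1 \<le> n" "n \<le> h"
  shows "(tree_egf h ^ k) $ n \<le> real k * (real n ^ n / (real n * fact n))"
proof (cases "k \<le> n")
  case True
  \<comment> \<open>The bound rests on \<open>n! / (n - k)! <= n ^ k\<close>, applied to the exact
    forest formula.\<close>
  have "fact n / fact (n - k) = (real (fact n div fact (n - k)))"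
    using fact_dvd[of "n - k" n, where 'a = nat] by (simp add: real_of_nat_div)
  also have "\<dots> \<le> real (n ^ k)"
    using fact_div_fact_le_pow[OF True] of_nat_mono by blast
  finally have "fact n \<le> real n ^ k * fact (n - k)"
    by (simp add: field_simps)
  then have "fact n * real n ^ (n - k) \<le> real n ^ k * fact (n - k) * real n ^ (n - k)"
    by (intro mult_right_mono) auto
  also have "\<dots> = real n ^ k * real n ^ (n - k) * fact (n - k)"
    by simp
  also have "\<dots> = real n ^ n * fact (n - k)"
    using True by (simp add: power_add[symmetric])
  finally show ?thesis
    unfolding tree_egf_power_nth[OF assms(1) True assms(3)]
    using assms by (simp add: divide_simps) (simp add: algebra_simps mult_left_mono)
next
  case False
  then have "(tree_egf h ^ k) $ n = 0"
    using startsby_zero_power_prefix[of "tree_egf h" k] by simp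
  then show ?thesis by simp
qed

text \<open>All \<open>n ^ n\<close> mappings are counted, since a tree on at most \<open>n\<close>
  vertices has height less than \<open>n <= N\<close>. The proof sums over the number
  \<open>k = n - j\<close> of cyclic vertices.\<close>

lemma seq_egf_nth:
  assumes "1 \<le> n" "n \<le> N"
  shows "seq_egf N $ n = real n ^ n / fact n"
proof -
  \<comment> \<open>For \<open>j > 0\<close> the summand is
    \<open>n^j / j! - n^(j-1) / (j-1)!\<close>, so the sum telescopes.\<close>
  have partial: "(\<Sum>j<m. real n ^ j * (real n - real j) / (real n * fact j)) = real n ^ m / (real n * fact (m - 1))"
    if "m \<ge> 1" for m
    using that
  proof (induction m rule: nat_induct_at_least)
    case base
    then show ?case using assms by simp
  next
    case (Suc m)
    then have "fact m = real m * fact (m - 1)" by (cases m) auto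
    then show ?case using Suc assms by (simp add: divide_simps) (simp add: algebra_simps)
  qed
  have "seq_egf N $ n = (\<Sum>k=0..n. (tree_egf N ^ k) $ n)"
    by (simp add: seq_egf_def fps_compose_nth fps_geom_def)
  also have "\<dots> = (\<Sum>k=1..n. (tree_egf N ^ k) $ n)"
    using assms by (subst sum.atLeast_Suc_atMost) auto
  also have "\<dots> = (\<Sum>k=1..n. real n ^ (n - k) * real k / (real n * fact (n - k)))"
    using assms by (intro sum.cong) (auto simp: tree_egf_power_nth)
  also have "\<dots> = (\<Sum>j<n. real n ^ j * (real n - real j) / (real n * fact j))"
    by (rule sum.reindex_bij_witness[of _ "\<lambda>j. n - j" "\<lambda>k. n - k"]) (auto simp: of_nat_diff)
  also have "\<dots> = real n ^ n / (real n * fact (n - 1))"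
    by (rule partial[OF assms(1)])
  also have "real n * fact (n - 1) = (fact n :: real)"
    using assms by (cases n) auto
  finally show ?thesis .
qed

text \<open>The coefficient \<open>1 / k\<close> of the logarithm cancels the \<open>k\<close> of
  the forest formula; what remains is \<open>n^n / (n * n!)\<close> times Ramanujan's
  \<open>Q(n)\<close>.\<close>

lemma log_egf_nth:
  assumes "1 \<le> n" "n \<le> N"
  shows "(fps_log oo tree_egf N) $ n = (\<Sum>k=1..n. real n ^ (n - k) / (real n * fact (n - k)))"
proof -
  have "(fps_log oo tree_egf N) $ n = (\<Sum>k=1..n. 1 / real k * (tree_egf N ^ k) $ n)"
    unfolding fps_compose_nth by (subst sum.atLeast_Suc_atMost) (auto simp: fps_log_def)
  also have "\<dots> = (\<Sum>k=1..n. real n ^ (n - k) / (real n * fact (n - k)))"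
    using assms by (intro sum.cong) (auto simp: tree_egf_power_nth)
  finally show ?thesis .
qed

lemma unique_egf_nth_bounds:
  assumes "2 \<le> n" "n \<le> N"
  defines "c \<equiv> real n ^ n / (real n * fact n)"
  shows "\<bar>2 * (seq_egf N $ n - unique_egf N $ n) - (fps_log oo tree_egf N) $ n\<bar>
     \<le> 19 * c"
proof -
  define L where "L = (fps_log oo tree_egf N)"
  define T where "T = tree_egf (Suc N)"
  define S where "S = (\<Sum>h<N. seq_egf (Suc h) * height_egf h)"
  define E2 where "E2 = (\<Sum>h<N. seq_egf (Suc h) ^ 2 * (height_egf (Suc h) - tree_egf (Suc h) * height_egf h))"
  define E3 where "E3 = (\<Sum>h<N. height_egf h ^ 3 * seq_egf h ^ 2 * seq_egf (Suc h) ^ 2)"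
  define D where "D = (\<Sum>h<N. height_egf h ^ 2 * seq_egf h ^ 2 * seq_egf (Suc h))"
  have AT: "fps_le N (tree_egf N) T" and T0: "fps_le N 0 T"
    unfolding T_def by (rule tree_egf_mono_Suc tree_egf_nonneg)+
  have two: "fps_le N 0 2"
    using fps_le_0_add[OF fps_le_0_1 fps_le_0_1] by simp
  have G: "fps_le N (2 * tree_egf N + tree_egf N ^ 2) (2 * T + T ^ 2)"
    by (intro fps_le_add fps_le_mult_left fps_le_power AT two tree_egf_nonneg)
  have G0: "fps_le N 0 (2 * tree_egf N + tree_egf N ^ 2)"
    by (intro fps_le_0_add fps_le_0_mult fps_le_0_power two tree_egf_nonneg)
  have "fps_le N E3 ((1 + T) * (2 * T + T ^ 2))"
    unfolding E3_def
    by (rule fps_le_trans[OF sum_height_cube_le], intro fps_le_mult fps_le_add AT G G0 fps_le_0_add fps_le_0_1 T0 fps_le_refl)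
  moreover have "fps_le N E2 (T * (2 * T + T ^ 2))"
    unfolding E2_def
    by (rule fps_le_trans[OF sum_height_defect_bounds(2)], unfold T_def[symmetric], intro fps_le_mult_left G T0)
  moreover have "fps_le N S (L + T)"
    unfolding S_def L_def
    by (rule fps_le_trans[OF log_egf_bounds(2)], intro fps_le_add AT fps_le_refl)
  ultimately have "fps_le N (S + (E2 + E3)) (L + T + (T * (2 * T + T ^ 2) + (1 + T) * (2 * T + T ^ 2)))"
    by (intro fps_le_add)
  \<comment> \<open>The error is \<open>3 T + 5 T^2 + 2 T^3\<close>, split into single powers. The
    coefficient of \<open>T^k\<close> is at most \<open>k * c\<close>, whence
    \<open>19 = 3 * 1 + 5 * 2 + 2 * 3\<close>.\<close>
  also have "L + T + (T * (2 * T + T ^ 2) + (1 + T) * (2 * T + T ^ 2)) =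
      L + (T ^ 1 + T ^ 1 + T ^ 1 + T ^ 2 + T ^ 2 + T ^ 2 + T ^ 2 + T ^ 2 + T ^ 3 + T ^ 3)"
    by (simp add: algebra_simps power2_eq_square power3_eq_cube)
  finally have "(S + (E2 + E3)) $ n \<le> (L + (T ^ 1 + T ^ 1 + T ^ 1 + T ^ 2 + T ^ 2 + T ^ 2 + T ^ 2 + T ^ 2 + T ^ 3 + T ^ 3)) $ n"
    using assms(2) by (rule fps_le_nth)
  moreover have "(T ^ k) $ n \<le> real k * c" if "k \<ge> 1" for k
    unfolding T_def c_def using that assms(1,2) by (intro tree_egf_power_nth_le) auto
  from this[of 1] this[of 2] this[of 3]
  have "(T ^ 1) $ n \<le> c" "(T ^ 2) $ n \<le> 2 * c"
    "(T ^ 3) $ n \<le> 3 * c" by auto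
  ultimately have up: "S $ n + E2 $ n + E3 $ n - L $ n \<le> 19 * c"
    by (simp only: fps_add_nth)
  have "L $ n \<le> S $ n"
    unfolding L_def S_def by (rule fps_le_nth[OF log_egf_bounds(1) assms(2)])
  moreover have "0 \<le> E2 $ n"
    using fps_le_nth[OF sum_height_defect_bounds(1) assms(2)] unfolding E2_def by simp
  moreover have "fps_le N 0 E3"
    unfolding E3_def by (intro fps_le_0_sum fps_le_0_mult fps_le_0_power) auto
  then have "0 \<le> E3 $ n"
    using fps_le_nth[OF _ assms(2)] by fastforce
  moreover have "2 * D = S - E2 - E3 - fps_X + seq_egf N ^ 2 * height_egf N"
    unfolding S_def E2_def E3_def D_def by (rule non_unique_egf_eq)
  \<comment> \<open>\<open>2 <= n\<close> removes the term \<open>fps_X\<close>, and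
    \<open>n <= N\<close> removes the boundary term at \<open>N\<close>.\<close>
  then have "(2 * D) $ n = S $ n - E2 $ n - E3 $ n"
    using assms height_egf_mult_nth_eq_0[OF assms(2)] by simp
  moreover have "(2 * D) $ n = 2 * (D $ n)"
    unfolding mult_2 by (rule fps_add_nth)
  ultimately have "\<bar>2 * (D $ n) - L $ n\<bar> \<le> 19 * c"
    using up by linarith
  moreover have "D = seq_egf N - 1 - unique_egf N"
    unfolding D_def seq_egf_minus_unique_egf ..
  then have "D $ n = seq_egf N $ n - unique_egf N $ n"
    using assms by simp
  ultimately show ?thesis by (simp add: L_def)
qed

section \<open>Ramanujan's Q-function\<close>

lemma gauss_integrable: "(\<lambda>x::real. exp (- x\<^sup>2)) integrable_on {a..b}"
  by (intro integrable_continuous_real continuous_intros)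

lemma gauss_tendsto:
  "((\<lambda>y. integral {0..y} (\<lambda>x::real. exp (- x\<^sup>2))) \<longlongrightarrow> sqrt pi / 2) at_top"
proof -
  have si: "set_integrable lborel {0..} (\<lambda>x::real. exp (- x\<^sup>2))"
    using gaussian_moment_0 unfolding set_integrable_def has_bochner_integral_iff by simp
  have "((\<lambda>y. set_lebesgue_integral lborel {0..y} (\<lambda>x::real. exp (- x\<^sup>2))) \<longlongrightarrow> set_lebesgue_integral lborel {0..} (\<lambda>x::real. exp (- x\<^sup>2))) at_top"
    by (rule tendsto_set_lebesgue_integral_at_top[OF _ si]) auto
  moreover have "set_lebesgue_integral lborel {0..} (\<lambda>x::real. exp (- x\<^sup>2)) = sqrt pi / 2"
    using gaussian_moment_0 unfolding set_lebesgue_integral_def has_bochner_integral_iff by simp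
  moreover have "set_lebesgue_integral lborel {0..y} (\<lambda>x::real. exp (- x\<^sup>2)) = integral {0..y} (\<lambda>x::real. exp (- x\<^sup>2))" for y
    by (intro set_borel_integral_eq_integral(2) set_integrable_subset[OF si]) auto
  ultimately show ?thesis by simp
qed

text \<open>Left and right Riemann sums of mesh \<open>1 / c\<close> for a function that decreases
  on the nonnegative axis.\<close>

lemma gauss_sum_bounds:
  fixes c :: real
  assumes "c > 0"
  defines "J \<equiv> \<lambda>y. integral {0..y} (\<lambda>x::real. exp (- x\<^sup>2))"
  shows "c * J (real K / c) \<le> (\<Sum>k<K. exp (- (real k / c)\<^sup>2))"
    and "(\<Sum>k<K. exp (- (real (Suc k) / c)\<^sup>2)) \<le> c * J (real K / c)"
proof -
  have step: "J (real (Suc k) / c) = J (real k / c) + integral {real k / c..real (Suc k) / c} (\<lambda>x. exp (- x\<^sup>2))" for k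
    unfolding J_def using assms
    by (intro Henstock_Kurzweil_Integration.integral_combine[symmetric] gauss_integrable) (auto simp: divide_right_mono)
  have len: "c * (v * (real (Suc k) / c - real k / c)) = v" for k and v :: real
    using assms by (simp add: field_simps)
  have up: "c * integral {real k / c..real (Suc k) / c} (\<lambda>x. exp (- x\<^sup>2)) \<le> exp (- (real k / c)\<^sup>2)" for k
  proof -
    have "integral {real k / c..real (Suc k) / c} (\<lambda>x. exp (- x\<^sup>2)) \<le>
        integral {real k / c..real (Suc k) / c} (\<lambda>x. exp (- (real k / c)\<^sup>2))"
      using assms by (intro integral_le gauss_integrable) (auto intro!: power_mono)
    also have "\<dots> = exp (- (real k / c)\<^sup>2) * (real (Suc k) / c - real k / c)"
      using assms by (simp add: divide_right_mono)
    finally have "c * integral {real k / c..real (Suc k) / c} (\<lambda>x. exp (- x\<^sup>2)) \<le>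
        c * (exp (- (real k / c)\<^sup>2) * (real (Suc k) / c - real k / c))"
      using assms by (intro mult_left_mono) auto
    then show ?thesis unfolding len .
  qed
  have low: "exp (- (real (Suc k) / c)\<^sup>2) \<le> c * integral {real k / c..real (Suc k) / c} (\<lambda>x. exp (- x\<^sup>2))" for k
  proof -
    have "integral {real k / c..real (Suc k) / c} (\<lambda>x. exp (- (real (Suc k) / c)\<^sup>2)) \<le>
        integral {real k / c..real (Suc k) / c} (\<lambda>x. exp (- x\<^sup>2))"
    proof (intro integral_le gauss_integrable)
      fix x assume x: "x \<in> {real k / c..real (Suc k) / c}"
      then have "0 \<le> x" using assms by (auto intro: order_trans[rotated])
      then show "exp (- (real (Suc k) / c)\<^sup>2) \<le> exp (- x\<^sup>2)"
        using x by (auto intro!: power_mono)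
    qed auto
    moreover have "integral {real k / c..real (Suc k) / c} (\<lambda>x. exp (- (real (Suc k) / c)\<^sup>2)) =
       exp (- (real (Suc k) / c)\<^sup>2) * (real (Suc k) / c - real k / c)"
      using assms by (simp add: divide_right_mono mult.commute)
    ultimately have "exp (- (real (Suc k) / c)\<^sup>2) * (real (Suc k) / c - real k / c) \<le>
        integral {real k / c..real (Suc k) / c} (\<lambda>x. exp (- x\<^sup>2))"
      by linarith
    then have "c * (exp (- (real (Suc k) / c)\<^sup>2) * (real (Suc k) / c - real k / c)) \<le>
        c * integral {real k / c..real (Suc k) / c} (\<lambda>x. exp (- x\<^sup>2))"
      using assms by (intro mult_left_mono) auto
    then show ?thesis unfolding len .
  qed
  have "J 0 = 0" by (simp add: J_def)
  then show "c * J (real K / c) \<le> (\<Sum>k<K. exp (- (real k / c)\<^sup>2))"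
    by (induction K) (auto simp: step distrib_left simp del: of_nat_Suc intro!: add_mono up)
  show "(\<Sum>k<K. exp (- (real (Suc k) / c)\<^sup>2)) \<le> c * J (real K / c)"
    using \<open>J 0 = 0\<close>
    by (induction K) (auto simp: step distrib_left simp del: of_nat_Suc intro!: add_mono low)
qed

text \<open>The summand of \<open>Q(n)\<close>. In product form it vanishes for
  \<open>k > n > 0\<close> and can be compared with exponentials factor by factor.\<close>

definition fall_ratio :: "nat \<Rightarrow> nat \<Rightarrow> real" where
  "fall_ratio n k = (\<Prod>i<k. 1 - real i / real n)"

lemma fall_ratio_eq:
  assumes "k \<le> n" "n > 0"
  shows "fall_ratio n k = fact n / (fact (n - k) * real n ^ k)"
  using assms
proof (induction k)
  case (Suc k)
  have "fact (n - k) = real (n - k) * fact (n - Suc k)"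
    using Suc.prems by (metis Suc_diff_Suc Suc_le_lessD fact_Suc of_nat_fact of_nat_mult)
  moreover have "fall_ratio n (Suc k) = fall_ratio n k * (1 - real k / real n)"
    by (simp add: fall_ratio_def)
  moreover have "real (n - k) > 0" using Suc.prems by simp
  moreover have "1 - real k / real n = real (n - k) / real n"
    using Suc.prems by (simp add: field_simps of_nat_diff)
  ultimately show ?case using Suc by simp
qed (simp add: fall_ratio_def)

lemma fall_ratio_eq_0: "n < k \<Longrightarrow> n > 0 \<Longrightarrow> fall_ratio n k = 0"
  unfolding fall_ratio_def by (intro prod_zero) auto

lemma fall_ratio_nonneg: "n > 0 \<Longrightarrow> fall_ratio n k \<ge> 0"
  by (cases "k \<le> n") (auto simp: fall_ratio_eq fall_ratio_eq_0)

text \<open>From \<open>1 - x <= exp (- x)\<close>. The shift to \<open>Suc k\<close> makes the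
  exponent \<open>- k (k + 1) / (2 n)\<close>, which is at most
  \<open>- k^2 / (2 n)\<close>.\<close>

lemma fall_ratio_upper:
  assumes "n > 0" 
  shows "fall_ratio n (Suc k) \<le> exp (- (real k / sqrt (2 * real n))\<^sup>2)"
proof (cases "Suc k \<le> n")
  case True
  have "fall_ratio n (Suc k) \<le> (\<Prod>i<Suc k. exp (- (real i / real n)))"
    unfolding fall_ratio_def
  proof (intro prod_mono conjI)
    fix i assume "i \<in> {..<Suc k}"
    then show "0 \<le> 1 - real i / real n" using True assms by (simp add: field_simps)
    show "1 - real i / real n \<le> exp (- (real i / real n))"
      using exp_ge_add_one_self[of "- (real i / real n)"] by simp
  qed
  also have "\<dots> = exp (- (\<Sum>i<Suc k. real i) / real n)"
    by (simp add: exp_sum[symmetric] sum_negf sum_divide_distrib del: sum.lessThan_Suc prod.lessThan_Suc)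
  also have "(\<Sum>i<Suc k. real i) = real k * (real k + 1) / 2"
    by (induction k) (auto simp: field_simps)
  also have "exp (- (real k * (real k + 1) / 2) / real n) \<le> exp (- (real k / sqrt (2 * real n))\<^sup>2)"
    using assms by (simp add: power_divide field_simps power2_eq_square)
  finally show ?thesis .
qed (use assms in \<open>simp add: fall_ratio_eq_0\<close>)

text \<open>If \<open>2 k <= n\<close>, every factor satisfies
  \<open>ln (1 - x) >= - x - 2 x^2\<close>; the linear parts sum to at most
  \<open>k^2 / (2 n)\<close>, and \<open>exp (- y) >= 1 - y\<close> handles the quadratic ones. The
  constant 8, generous there, makes the right-hand side nonpositive when
  \<open>2 k > n\<close>.\<close>

lemma fall_ratio_lower:
  assumes "n > 0" 
  shows "fall_ratio n k \<ge> exp (- (real k / sqrt (2 * real n))\<^sup>2) * (1 - 8 * real k ^ 3 / real n ^ 2)"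
proof (cases "2 * k \<le> n")
  case True
  have le: "exp (- (real i / real n) - 2 * (real i / real n)\<^sup>2) \<le> 1 - real i / real n" if "i < k" for i
  proof -
    have i: "real i / real n \<le> 1 / 2" "0 \<le> real i / real n"
      using that True assms by (auto simp: field_simps)
    have "exp (- (real i / real n) - 2 * (real i / real n)\<^sup>2) \<le> exp (ln (1 - real i / real n))"
      using ln_one_minus_pos_lower_bound[OF i(2) i(1)] by simp
    also have "\<dots> = 1 - real i / real n"
    proof -
      have "1 - real i / real n > 0" using i by linarith
      then show ?thesis by (rule exp_ln)
    qed
    finally show ?thesis .
  qed
  have s1: "(\<Sum>i<k. real i / real n) \<le> (real k / sqrt (2 * real n))\<^sup>2"
  proof -
    have "(\<Sum>i<k. real i) \<le> real k ^ 2 / 2"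
      by (induction k) (auto simp: field_simps power2_eq_square)
    then have "(\<Sum>i<k. real i) / real n \<le> real k ^ 2 / 2 / real n"
      by (rule divide_right_mono) simp
    then show ?thesis
      using assms by (simp add: power_divide sum_divide_distrib)
  qed
  have s2: "(\<Sum>i<k. 2 * (real i / real n)\<^sup>2) \<le> 8 * real k ^ 3 / real n ^ 2"
  proof -
    have "(\<Sum>i<k. 2 * real i ^ 2) \<le> (\<Sum>i<k. 2 * real k ^ 2)"
      by (intro sum_mono mult_left_mono power_mono) auto
    also have "\<dots> \<le> 8 * real k ^ 3" by (simp add: power2_eq_square power3_eq_cube)
    finally have "(\<Sum>i<k. 2 * real i ^ 2) / real n ^ 2 \<le> 8 * real k ^ 3 / real n ^ 2"
      by (rule divide_right_mono) simp
    then show ?thesis by (simp add: power_divide sum_divide_distrib)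
  qed
  have "exp (- (real k / sqrt (2 * real n))\<^sup>2) * (1 - 8 * real k ^ 3 / real n ^ 2) \<le>
      exp (- (real k / sqrt (2 * real n))\<^sup>2) * exp (- (8 * real k ^ 3 / real n ^ 2))"
    using exp_ge_add_one_self[of "- (8 * real k ^ 3 / real n ^ 2)"] by (intro mult_left_mono) auto
  also have "\<dots> \<le> exp (\<Sum>i<k. - (real i / real n) - 2 * (real i / real n)\<^sup>2)"
    using s1 s2 by (simp add: exp_add[symmetric] sum_subtractf sum_negf)
  also have "\<dots> = (\<Prod>i<k. exp (- (real i / real n) - 2 * (real i / real n)\<^sup>2))"
    by (rule exp_sum) auto
  also have "\<dots> \<le> fall_ratio n k"
    unfolding fall_ratio_def by (intro prod_mono) (auto intro: le)
  finally show ?thesis .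
next
  case False
  then have "real n \<le> 2 * real k" "1 \<le> real k" by auto
  then have "real n ^ 2 * 1 \<le> (2 * real k) ^ 2 * (2 * real k)"
    using assms by (intro mult_mono power_mono) auto
  then have "real n ^ 2 \<le> 8 * real k ^ 3" by (simp add: power2_eq_square power3_eq_cube)
  then have "1 - 8 * real k ^ 3 / real n ^ 2 \<le> 0" using assms by (simp add: field_simps)
  then have "exp (- (real k / sqrt (2 * real n))\<^sup>2) * (1 - 8 * real k ^ 3 / real n ^ 2) \<le> 0"
    by (intro mult_nonneg_nonpos) auto
  then show ?thesis using fall_ratio_nonneg[OF assms, of k] by linarith
qed

text \<open>Replaces the Gaussian by a rational function whose sum can be telescoped. With
  \<open>x = k^2 / n\<close>, \<open>x (1 + x)^2 <= (1 + x)^3 <= 216 (1 + x / 6)^3 <= 216 exp (x /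
  2)\<close>; the 6 is chosen so that the cube of \<open>exp (x / 6)\<close> is the inverse of the
  Gaussian, and \<open>216 = 6^3\<close>.\<close>

lemma cube_exp_le:
  assumes "n > 0" 
  shows "real k ^ 3 * exp (- (real k / sqrt (2 * real n))\<^sup>2) \<le>
     216 * real n ^ 3 * (real k / (real n + real k ^ 2) ^ 2)"
proof -
  define x where "x = real k ^ 2 / real n"
  have x: "x \<ge> 0" by (simp add: x_def)
  have "x * (1 + x) ^ 2 \<le> (1 + x) * (1 + x) ^ 2"
    using x by (intro mult_right_mono) auto
  also have "\<dots> \<le> 216 * (1 + x / 6) ^ 3"
  proof -
    have "(1 + x) ^ 3 \<le> (6 * (1 + x / 6)) ^ 3"
      using x by (intro power_mono) auto
    also have "\<dots> = 6 ^ 3 * (1 + x / 6) ^ 3"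
      by (rule power_mult_distrib)
    finally show ?thesis by (simp add: power2_eq_square power3_eq_cube)
  qed
  also have "\<dots> \<le> 216 * exp (x / 6) ^ 3"
    using x by (intro mult_left_mono power_mono exp_ge_add_one_self) auto
  also have "exp (x / 6) ^ 3 = exp (x / 2)"
    by (simp add: exp_of_nat_mult[symmetric])
  finally have "x * (1 + x) ^ 2 \<le> 216 * exp (x / 2)" .
  then have "x * (1 + x) ^ 2 * exp (- (x / 2)) \<le> 216"
    by (simp add: exp_minus field_simps)
  then have "real k * real n * (x * (1 + x) ^ 2 * exp (- (x / 2))) \<le> real k * real n * 216"
    by (intro mult_left_mono) auto
  moreover have "(1 + x) ^ 2 > 0" using x by simp
  ultimately have "real k * real n * x * exp (- (x / 2)) \<le> 216 * (real k * real n) / (1 + x) ^ 2"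
    by (simp add: pos_le_divide_eq mult_ac)
  moreover have "(real k / sqrt (2 * real n))\<^sup>2 = x / 2"
    using assms by (simp add: x_def power_divide)
  moreover have "real k ^ 3 = real k * real n * x"
    using assms by (simp add: x_def power2_eq_square power3_eq_cube)
  moreover have "real n + real k ^ 2 = real n * (1 + x)"
    using assms by (simp add: x_def field_simps)
  moreover have "216 * real n ^ 3 * (real k / (real n * (1 + x)) ^ 2) = 216 * (real k * real n) / (1 + x) ^ 2"
    using assms by (simp add: power_mult_distrib power2_eq_square power3_eq_cube)
  ultimately show ?thesis by (simp only:)
qed

text \<open>With \<open>N = n + k^2\<close>,
  \<open>k / N^2 <= k / (N^2 - k^2) = (1 / (N - k) - 1 / (N + k)) / 2\<close>, and
  \<open>N + k\<close> is the value of \<open>N - k\<close> for \<open>Suc k\<close>. So the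
  rational sum telescopes to at most \<open>1 / (2 n)\<close>, whatever \<open>K\<close> is.\<close>

lemma sum_cube_exp_le:
  assumes "n > 0" 
  shows "(\<Sum>k<K. real k ^ 3 * exp (- (real k / sqrt (2 * real n))\<^sup>2)) \<le> 108 * real n ^ 2"
proof -
  have "(\<Sum>k<K. real k / (real n + real k ^ 2) ^ 2) \<le> (1 / real n - 1 / (real n + real K * (real K - 1))) / 2"
  proof (induction K)
    case (Suc K)
    define N m where "N = real n + real K ^ 2" and "m = real K"
    have m: "0 \<le> m" by (simp add: m_def)
    have "m \<le> real K ^ 2"
      unfolding m_def by (cases K) (auto simp: power2_eq_square)
    then have N: "m < N" using assms by (simp add: N_def)
    then have "m * m < N * N" using m by (intro mult_strict_mono) auto
    then have "m / N ^ 2 \<le> m / (N ^ 2 - m ^ 2)"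
      using m N by (intro divide_left_mono) (auto simp: power2_eq_square)
    also have "\<dots> = (1 / (N - m) - 1 / (N + m)) / 2"
      using m N by (simp add: divide_simps) (simp add: algebra_simps power2_eq_square)
    finally have "m / N ^ 2 \<le> (1 / (N - m) - 1 / (N + m)) / 2" .
    moreover have "N - m = real n + real K * (real K - 1)"
      "N + m = real n + real (Suc K) * (real (Suc K) - 1)"
      by (auto simp: N_def m_def algebra_simps power2_eq_square)
    ultimately have "real K / (real n + real K ^ 2) ^ 2 \<le>
        (1 / (real n + real K * (real K - 1)) - 1 / (real n + real (Suc K) * (real (Suc K) - 1))) / 2"
      by (simp only: N_def m_def)
    then show ?case using Suc by (simp del: of_nat_Suc) 
  qed auto
  also have "\<dots> \<le> 1 / (2 * real n)"
  proof -
    have "real K * (real K - 1) \<ge> 0" by (cases K) auto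
    then have "1 / (real n + real K * (real K - 1)) \<ge> 0" by simp
    then show ?thesis by simp
  qed
  finally have "216 * real n ^ 3 * (\<Sum>k<K. real k / (real n + real k ^ 2) ^ 2) \<le> 216 * real n ^ 3 * (1 / (2 * real n))"
    by (intro mult_left_mono) auto
  also have "216 * real n ^ 3 * (1 / (2 * real n)) = 108 * real n ^ 2"
    using assms by (simp add: power2_eq_square power3_eq_cube)
  finally have "216 * real n ^ 3 * (\<Sum>k<K. real k / (real n + real k ^ 2) ^ 2) \<le> 108 * real n ^ 2" .
  moreover have "(\<Sum>k<K. real k ^ 3 * exp (- (real k / sqrt (2 * real n))\<^sup>2)) \<le>
      216 * real n ^ 3 * (\<Sum>k<K. real k / (real n + real k ^ 2) ^ 2)"
    unfolding sum_distrib_left by (intro sum_mono cube_exp_le assms)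
  ultimately show ?thesis by linarith
qed

text \<open>\<open>Q(n)\<close> is compared with Riemann sums of mesh \<open>1 / sqrt (2 n)\<close>.
  The upper bound costs \<open>1\<close>; in the lower bound \<open>8 * 108 = 864\<close> comes from
  the cubic error and another \<open>1\<close> from the summand at \<open>k = 0\<close>.\<close>

theorem fall_ratio_sum_bounds:
  assumes n: "n > 0"
  shows "\<bar>(\<Sum>k=1..n. fall_ratio n k) - sqrt (pi * real n / 2)\<bar> \<le> 865"
proof -
  define c where "c = sqrt (2 * real n)"
  define J where "J = (\<lambda>y. integral {0..y} (\<lambda>x::real. exp (- x\<^sup>2)))"
  have c: "c > 0" using n by (simp add: c_def)
  have lim: "((\<lambda>K. c * J (real K / c)) \<longlongrightarrow> c * (sqrt pi / 2)) sequentially"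
    using c unfolding J_def
    by (intro tendsto_mult_left filterlim_compose[OF gauss_tendsto]) real_asymp
  have ceq: "c * (sqrt pi / 2) = sqrt (pi * real n / 2)"
  proof (rule real_sqrt_unique[symmetric])
    show "(c * (sqrt pi / 2))\<^sup>2 = pi * real n / 2"
      using c by (simp add: c_def power_mult_distrib power_divide)
  qed (use c in auto)
  have Jmono: "c * J (real K / c) \<le> c * (sqrt pi / 2)" for K
  proof (rule tendsto_lowerbound[OF lim])
    show "\<forall>\<^sub>F K' in sequentially. c * J (real K / c) \<le> c * J (real K' / c)"
      using eventually_ge_at_top[of K]
    proof eventually_elim
      case (elim K')
      then show ?case unfolding J_def using c
        by (intro mult_left_mono integral_subset_le gauss_integrable) (auto simp: divide_right_mono intro: order_trans)
    qed
  qed auto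
  have "(\<Sum>k=1..n. fall_ratio n k) = (\<Sum>k<n. fall_ratio n (Suc k))"
    by (rule sum.reindex_bij_witness[of _ Suc "\<lambda>k. k - 1"]) auto
  also have "\<dots> \<le> (\<Sum>k<n. exp (- (real k / c)\<^sup>2))"
    unfolding c_def by (intro sum_mono fall_ratio_upper n)
  also have "\<dots> \<le> 1 + (\<Sum>k<n. exp (- (real (Suc k) / c)\<^sup>2))"
  proof -
    have "(\<Sum>k<n. exp (- (real k / c)\<^sup>2)) \<le> (\<Sum>k<Suc n. exp (- (real k / c)\<^sup>2))"
      by simp
    also have "\<dots> = 1 + (\<Sum>k<n. exp (- (real (Suc k) / c)\<^sup>2))"
      by (subst sum.lessThan_Suc_shift) simp
    finally show ?thesis .
  qed
  also have "\<dots> \<le> 1 + sqrt (pi * real n / 2)"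
    using gauss_sum_bounds(2)[OF c, of n] Jmono[of n] unfolding ceq J_def by simp
  finally have up: "(\<Sum>k=1..n. fall_ratio n k) \<le> 1 + sqrt (pi * real n / 2)" .
  \<comment> \<open>Beyond \<open>n\<close> the ratios vanish, so \<open>K\<close> may tend to
    infinity and the integral reaches the full half-line.\<close>
  have low: "c * J (real K / c) \<le> 865 + (\<Sum>k=1..n. fall_ratio n k)" if "K > n" for K
  proof -
    have "c * J (real K / c) \<le> (\<Sum>k<K. exp (- (real k / c)\<^sup>2))"
      unfolding J_def by (rule gauss_sum_bounds(1)[OF c])
    also have "\<dots> \<le> (\<Sum>k<K. fall_ratio n k + 8 / real n ^ 2 * (real k ^ 3 * exp (- (real k / c)\<^sup>2)))"
    proof (rule sum_mono)
      fix k
      show "exp (- (real k / c)\<^sup>2) \<le> fall_ratio n k + 8 / real n ^ 2 * (real k ^ 3 * exp (- (real k / c)\<^sup>2))"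
        using fall_ratio_lower[OF n, of k] by (simp add: c_def algebra_simps)
    qed
    also have "\<dots> = (\<Sum>k<K. fall_ratio n k) + 8 / real n ^ 2 * (\<Sum>k<K. real k ^ 3 * exp (- (real k / c)\<^sup>2))"
      by (simp add: sum.distrib sum_distrib_left)
    also have "\<dots> \<le> (\<Sum>k<K. fall_ratio n k) + 8 / real n ^ 2 * (108 * real n ^ 2)"
      unfolding c_def by (intro add_left_mono mult_left_mono sum_cube_exp_le n) auto
    also have "(\<Sum>k<K. fall_ratio n k) = (\<Sum>k\<in>insert 0 {1..n}. fall_ratio n k)"
      using that n by (intro sum.mono_neutral_right) (auto simp: fall_ratio_eq_0)
    also have "\<dots> = 1 + (\<Sum>k=1..n. fall_ratio n k)"
      by (simp add: fall_ratio_def)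
    finally show ?thesis using n by simp
  qed
  have "sqrt (pi * real n / 2) \<le> 865 + (\<Sum>k=1..n. fall_ratio n k)"
    unfolding ceq[symmetric]
    by (rule tendsto_upperbound[OF lim]) (use low in \<open>auto intro: eventually_mono[OF eventually_gt_at_top[of n]]\<close>)
  with up show ?thesis by linarith
qed

section \<open>Counting forests\<close>

lemma fps_linear_ode_unique:
  fixes y z :: "real fps"
  assumes "fps_deriv y = y * a" "fps_deriv z = z * a" "y $ 0 = z $ 0"
  shows "y = z"
proof (rule fps_ext)
  fix n
  show "y $ n = z $ n"
  proof (induction n rule: less_induct)
    case (less n)
    show ?case
    proof (cases n)
      case (Suc m)
      have "fps_deriv y $ m = fps_deriv z $ m"
        unfolding assms fps_mult_nth using less Suc by (intro sum.cong) auto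
      then show ?thesis using Suc by simp
    qed (use assms in simp)
  qed
qed

text \<open>Both sides solve \<open>y' = y (f' + g')\<close> with constant term
  \<open>1\<close>.\<close>

lemma fps_exp_compose_add:
  fixes f g :: "real fps"
  assumes "f $ 0 = 0" "g $ 0 = 0"
  shows "fps_exp 1 oo (f + g) = (fps_exp 1 oo f) * (fps_exp 1 oo g)"
  by (rule fps_linear_ode_unique[where a = "fps_deriv f + fps_deriv g"])
    (use assms in \<open>simp_all add: fps_compose_deriv algebra_simps\<close>)

lemma fps_exp_compose_sum:
  fixes f :: "'a \<Rightarrow> real fps"
  assumes "finite S" "\<And>x. x \<in> S \<Longrightarrow> f x $ 0 = 0"
  shows "fps_exp 1 oo (\<Sum>x\<in>S. f x) = (\<Prod>x\<in>S. fps_exp 1 oo f x)"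
  using assms
proof (induction S)
  case (insert x S)
  then show ?case by (simp add: fps_exp_compose_add fps_sum_nth)
qed simp

lemma sum_PiE_prod_eq_power:
  fixes g :: "'b \<Rightarrow> 'c::comm_semiring_1"
  assumes "finite S" "finite R"
  shows "(\<Sum>p\<in>S \<rightarrow>\<^sub>E R. \<Prod>s\<in>S. g (p s)) = (\<Sum>r\<in>R. g r) ^ card S"
  using assms(1)
proof (induction S)
  case (insert x S)
  have "(\<Sum>p\<in>insert x S \<rightarrow>\<^sub>E R. \<Prod>s\<in>insert x S. g (p s)) =
      (\<Sum>(y, p)\<in>R \<times> (S \<rightarrow>\<^sub>E R). \<Prod>s\<in>insert x S. g ((p(x := y)) s))"
    unfolding PiE_insert_eq using insert.hyps
    by (subst sum.reindex[OF inj_combinator]) (auto simp: case_prod_unfold)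
  also have "\<dots> = (\<Sum>(y, p)\<in>R \<times> (S \<rightarrow>\<^sub>E R). g y * (\<Prod>s\<in>S. g (p s)))"
  proof (intro sum.cong refl, clarify)
    fix a b
    have "(\<Prod>s\<in>S. g ((b(x := a)) s)) = (\<Prod>s\<in>S. g (b s))"
      using insert.hyps by (intro prod.cong refl) auto
    then show "(\<Prod>s\<in>insert x S. g ((b(x := a)) s)) = g a * (\<Prod>s\<in>S. g (b s))"
      using insert.hyps by (simp del: fun_upd_apply) simp
  qed
  also have "\<dots> = (\<Sum>r\<in>R. g r) * (\<Sum>p\<in>S \<rightarrow>\<^sub>E R. \<Prod>s\<in>S. g (p s))"
    by (simp add: sum.cartesian_product[symmetric] sum_product)
  finally show ?case using insert by simp
qed simp

lemma sum_Pow_card: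
  fixes g :: "nat \<Rightarrow> 'b::comm_semiring_1"
  assumes "finite A"
  shows "(\<Sum>S\<in>Pow A. g (card S)) = (\<Sum>s\<le>card A. of_nat (card A choose s) * g s)"
proof -
  have "(\<Sum>S\<in>Pow A. g (card S)) = (\<Sum>s\<le>card A. \<Sum>S\<in>{S \<in> Pow A. card S = s}. g (card S))"
    using assms by (intro sum.group[symmetric]) (auto intro: card_mono)
  also have "\<dots> = (\<Sum>s\<le>card A. of_nat (card A choose s) * g s)"
    using assms by (intro sum.cong refl) (simp add: n_subsets)
  finally show ?thesis .
qed

text \<open>\<open>tree_level f N r k\<close> is the set of vertices at distance exactly \<open>k\<close> from the root \<open>r\<close> in a forest on the
  non-root vertices \<open>N\<close>; \<open>f\<close> is never iterated, so its values outside \<open>N\<close> do not matter.\<close>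

primrec tree_level :: "('a \<Rightarrow> 'a) \<Rightarrow> 'a set \<Rightarrow> 'a \<Rightarrow> nat \<Rightarrow> 'a set" where
  "tree_level f N r 0 = {r}"
| "tree_level f N r (Suc k) = {y \<in> N. f y \<in> tree_level f N r k}"

text \<open>The covering condition says that every non-root vertex reaches a root, which excludes
  cycles.\<close>

definition all_forests :: "'a set \<Rightarrow> 'a set \<Rightarrow> ('a \<Rightarrow> 'a) set" where
  "all_forests R N = {f \<in> N \<rightarrow>\<^sub>E R \<union> N. N \<subseteq> (\<Union>r\<in>R. \<Union>k. tree_level f N r k)}"

text \<open>An empty level \<open>b r\<close> means that the tree at \<open>r\<close> has height
  less than \<open>b r\<close>. The bound varies with the root so that one tree may be allowed to be
  higher, and so that replacing the roots by their children leads to sets of the same kind.\<close>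

definition forests :: "('a \<Rightarrow> nat) \<Rightarrow> 'a set \<Rightarrow> 'a set \<Rightarrow> ('a \<Rightarrow> 'a) set" where
  "forests b R N = {f \<in> all_forests R N. \<forall>r\<in>R. tree_level f N r (b r) = {}}"

lemma finite_all_forests: "finite R \<Longrightarrow> finite N \<Longrightarrow> finite (all_forests R N)"
  unfolding all_forests_def by (rule finite_subset[of _ "N \<rightarrow>\<^sub>E R \<union> N"]) (auto intro!: finite_PiE)

lemma finite_forests: "finite R \<Longrightarrow> finite N \<Longrightarrow> finite (forests b R N)"
  by (rule finite_subset[of _ "all_forests R N"]) (auto simp: forests_def finite_all_forests)

lemma tree_level_cong: "(\<And>y. y \<in> N \<Longrightarrow> f y = f' y) \<Longrightarrow> tree_level f N r k = tree_level f' N r k"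
  by (induction k) auto

text \<open>The set \<open>S\<close> of children of roots becomes the root set of the remaining
  forest, with all levels lowered by one. Only the values of \<open>f'\<close> on
  \<open>N - S\<close> are prescribed, so a restriction of \<open>f\<close> can serve.\<close>

lemma tree_level_Suc_eq:
  assumes "R \<inter> N = {}" "r \<in> R" "\<And>y. y \<in> N \<Longrightarrow> f y \<notin> R \<Longrightarrow> f' y = f y"
  defines "S \<equiv> {y \<in> N. f y \<in> R}"
  shows "tree_level f N r (Suc k) = (\<Union>s\<in>{s\<in>S. f s = r}. tree_level f' (N - S) s k)"
proof (induction k)
  case 0
  then show ?case using assms by auto
next
  case (Suc k)
  have sub: "tree_level f N r (Suc k) \<subseteq> N" by auto
  have "tree_level f N r (Suc (Suc k)) = {y \<in> N - S. f' y \<in> tree_level f N r (Suc k)}"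
  proof (intro equalityI subsetI)
    fix y assume "y \<in> tree_level f N r (Suc (Suc k))"
    then have y: "y \<in> N" "f y \<in> tree_level f N r (Suc k)" by auto
    with sub assms(1) have "f y \<notin> R" by blast
    then show "y \<in> {y \<in> N - S. f' y \<in> tree_level f N r (Suc k)}"
      using y assms(3)[of y] by (simp add: S_def)
  next
    fix y assume "y \<in> {y \<in> N - S. f' y \<in> tree_level f N r (Suc k)}"
    then show "y \<in> tree_level f N r (Suc (Suc k))"
      using assms(3)[of y] by (simp add: S_def)
  qed
  also have "\<dots> = (\<Union>s\<in>{s\<in>S. f s = r}. tree_level f' (N - S) s (Suc k))"
    unfolding Suc by auto
  finally show ?case .
qed

text \<open>Removing the roots turns the bound \<open>b r\<close> into \<open>b r - 1\<close> for
  each child of \<open>r\<close>; positivity of \<open>b\<close> keeps this subtraction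
  exact.\<close>

lemma mem_forests_iff:
  assumes RN: "R \<inter> N = {}" and b: "\<And>r. r \<in> R \<Longrightarrow> b r > 0" and f: "f \<in> N \<rightarrow>\<^sub>E R \<union> N"
  defines "S \<equiv> {y \<in> N. f y \<in> R}"
  shows "f \<in> forests b R N \<longleftrightarrow> restrict f (N - S) \<in> forests (\<lambda>s. b (f s) - 1) S (N - S)"
proof -
  let ?f = "restrict f (N - S)"
  have eq: "tree_level f N r (Suc k) = (\<Union>s\<in>{s\<in>S. f s = r}. tree_level ?f (N - S) s k)" if "r \<in> R" for r k
    unfolding S_def by (rule tree_level_Suc_eq[OF RN that]) auto
  have "?f \<in> N - S \<rightarrow>\<^sub>E S \<union> (N - S)"
    using f by (auto simp: S_def PiE_iff)
  moreover have "N \<subseteq> (\<Union>r\<in>R. \<Union>k. tree_level f N r k) \<longleftrightarrow> N - S \<subseteq> (\<Union>s\<in>S. \<Union>k. tree_level ?f (N - S) s k)"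
  proof -
    have "(\<Union>k. tree_level f N r k) = insert r (\<Union>k. tree_level f N r (Suc k))" for r
    proof (intro equalityI subsetI)
      fix y assume "y \<in> (\<Union>k. tree_level f N r k)"
      then obtain k where "y \<in> tree_level f N r k" by blast
      then show "y \<in> insert r (\<Union>k. tree_level f N r (Suc k))"
        by (cases k) (auto simp del: tree_level.simps(2))
    next
      fix y assume "y \<in> insert r (\<Union>k. tree_level f N r (Suc k))"
      then show "y \<in> (\<Union>k. tree_level f N r k)"
        using UN_I[of 0 UNIV r "tree_level f N r"] by (auto simp del: tree_level.simps(2))
    qed
    then have "(\<Union>r\<in>R. \<Union>k. tree_level f N r k) = R \<union> (\<Union>r\<in>R. \<Union>k. tree_level f N r (Suc k))"
      by auto
    also have "(\<Union>r\<in>R. \<Union>k. tree_level f N r (Suc k)) = (\<Union>s\<in>S. \<Union>k. tree_level ?f (N - S) s k)"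
      using eq by (auto simp: S_def simp del: tree_level.simps)
    finally have "(\<Union>r\<in>R. \<Union>k. tree_level f N r k) = R \<union> (\<Union>s\<in>S. \<Union>k. tree_level ?f (N - S) s k)" .
    moreover have "S \<subseteq> (\<Union>s\<in>S. \<Union>k. tree_level ?f (N - S) s k)"
      using tree_level.simps(1) by fast
    moreover have "N \<subseteq> R \<union> Z \<longleftrightarrow> N - S \<subseteq> Z" if "S \<subseteq> Z" for Z
      using that RN by blast
    ultimately show ?thesis by (simp only:)
  qed
  moreover have "(\<forall>r\<in>R. tree_level f N r (b r) = {}) \<longleftrightarrow> (\<forall>s\<in>S. tree_level ?f (N - S) s (b (f s) - 1) = {})"
  proof -
    have "tree_level f N r (b r) = (\<Union>s\<in>{s\<in>S. f s = r}. tree_level ?f (N - S) s (b r - 1))" if "r \<in> R" for r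
      using eq[OF that, of "b r - 1"] b[OF that] by simp
    then show ?thesis by (auto simp: S_def)
  qed
  ultimately show ?thesis
    using f by (simp add: forests_def all_forests_def)
qed

text \<open>A forest amounts to the set \<open>S\<close> of children of roots, their parent map
  \<open>p\<close>, and a forest with roots \<open>S\<close> on the remaining vertices.\<close>

lemma forests_bij_betw:
  assumes RN: "R \<inter> N = {}" and b: "\<And>r. r \<in> R \<Longrightarrow> b r > 0"
  shows "bij_betw (\<lambda>(S, p, f) x. if x \<in> S then p x else f x)
    (SIGMA S:Pow N. SIGMA p:S \<rightarrow>\<^sub>E R. forests (\<lambda>s. b (p s) - 1) S (N - S)) (forests b R N)"
    (is "bij_betw ?h ?A _")
proof (rule bij_betw_byWitness[where f' = "\<lambda>f. let S = {y \<in> N. f y \<in> R} in (S, restrict f S, restrict f (N - S))"])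
  have key: "{y \<in> N. ?h (S, p, f) y \<in> R} = S" "restrict (?h (S, p, f)) S = p"
    "restrict (?h (S, p, f)) (N - S) = f" "?h (S, p, f) \<in> N \<rightarrow>\<^sub>E R \<union> N"
    "forests (\<lambda>s. b (?h (S, p, f) s) - 1) S (N - S) = forests (\<lambda>s. b (p s) - 1) S (N - S)"
    if "(S, p, f) \<in> ?A" for S p f
  proof -
    from that have S: "S \<subseteq> N" and p: "p \<in> S \<rightarrow>\<^sub>E R" and f: "f \<in> N - S \<rightarrow>\<^sub>E S \<union> (N - S)"
      by (auto simp: forests_def all_forests_def)
    from f S have fN: "f y \<in> N" if "y \<in> N - S" for y
      using that by (auto simp: PiE_iff)
    show "{y \<in> N. ?h (S, p, f) y \<in> R} = S"
      using S p fN RN by (auto simp: PiE_iff)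
    show "restrict (?h (S, p, f)) S = p"
      using p by (auto simp: fun_eq_iff restrict_def PiE_iff extensional_def)
    show "restrict (?h (S, p, f)) (N - S) = f"
      using f by (auto simp: fun_eq_iff restrict_def PiE_iff extensional_def)
    show "?h (S, p, f) \<in> N \<rightarrow>\<^sub>E R \<union> N"
      using S p f fN by (auto simp: PiE_iff extensional_def)
    show "forests (\<lambda>s. b (?h (S, p, f) s) - 1) S (N - S) = forests (\<lambda>s. b (p s) - 1) S (N - S)"
      by (auto simp: forests_def)
  qed
  show "\<forall>a\<in>?A. (let S = {y \<in> N. ?h a y \<in> R} in (S, restrict (?h a) S, restrict (?h a) (N - S))) = a"
  proof
    fix a assume a: "a \<in> ?A"
    obtain S p f where "a = (S, p, f)" by (cases a) auto
    with a key[of S p f] show "(let S = {y \<in> N. ?h a y \<in> R} in (S, restrict (?h a) S, restrict (?h a) (N - S))) = a"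
      by (simp only: Let_def)
  qed
  show "\<forall>f\<in>forests b R N. ?h (let S = {y \<in> N. f y \<in> R} in (S, restrict f S, restrict f (N - S))) = f"
    by (auto simp: Let_def fun_eq_iff forests_def all_forests_def PiE_iff extensional_def)
  show "?h ` ?A \<subseteq> forests b R N"
  proof (rule image_subsetI)
    fix a assume a: "a \<in> ?A"
    obtain S p f where a': "a = (S, p, f)" by (cases a) auto
    have "f \<in> forests (\<lambda>s. b (p s) - 1) S (N - S)" using a a' by auto
    then show "?h a \<in> forests b R N"
      using mem_forests_iff[where b = b, OF RN b key(4)[OF a[unfolded a']]] unfolding a' key[OF a[unfolded a']] by blast
  qed
  show "(\<lambda>f. let S = {y \<in> N. f y \<in> R} in (S, restrict f S, restrict f (N - S))) ` forests b R N \<subseteq> ?A"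
  proof (rule image_subsetI)
    fix f assume f: "f \<in> forests b R N"
    define S where "S = {y \<in> N. f y \<in> R}"
    have "f \<in> N \<rightarrow>\<^sub>E R \<union> N" using f by (simp add: forests_def all_forests_def)
    then have "restrict f (N - S) \<in> forests (\<lambda>s. b (f s) - 1) S (N - S)"
      using mem_forests_iff[where b = b, OF RN b] f unfolding S_def by blast
    moreover have "forests (\<lambda>s. b (restrict f S s) - 1) S (N - S) = forests (\<lambda>s. b (f s) - 1) S (N - S)"
      by (auto simp: forests_def)
    moreover have "S \<subseteq> N" "restrict f S \<in> S \<rightarrow>\<^sub>E R"
      by (auto simp: S_def)
    ultimately have "(S, restrict f S, restrict f (N - S)) \<in> ?A"
      by (simp only: mem_Sigma_iff Pow_iff simp_thms)
    then show "(let S = {y \<in> N. f y \<in> R} in (S, restrict f S, restrict f (N - S))) \<in> ?A"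
      unfolding Let_def S_def .
  qed
qed

lemma card_forests_rec:
  assumes "finite R" "finite N" "R \<inter> N = {}" "\<And>r. r \<in> R \<Longrightarrow> b r > 0"
  shows "card (forests b R N) =
    (\<Sum>S\<in>Pow N. \<Sum>p\<in>S \<rightarrow>\<^sub>E R. card (forests (\<lambda>s. b (p s) - 1) S (N - S)))"
proof -
  have fin: "finite S" if "S \<subseteq> N" for S using that assms finite_subset by blast
  have "card (forests b R N) = card (SIGMA S:Pow N. SIGMA p:S \<rightarrow>\<^sub>E R. forests (\<lambda>s. b (p s) - 1) S (N - S))"
    by (rule bij_betw_same_card[symmetric], rule forests_bij_betw) (use assms in auto)
  also have "\<dots> = (\<Sum>S\<in>Pow N. card (SIGMA p:S \<rightarrow>\<^sub>E R. forests (\<lambda>s. b (p s) - 1) S (N - S)))"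
    using assms fin by (intro card_SigmaI) (auto intro!: finite_SigmaI finite_PiE finite_forests)
  also have "\<dots> = (\<Sum>S\<in>Pow N. \<Sum>p\<in>S \<rightarrow>\<^sub>E R. card (forests (\<lambda>s. b (p s) - 1) S (N - S)))"
    using assms fin by (intro sum.cong refl card_SigmaI) (auto intro!: finite_PiE finite_forests)
  finally show ?thesis .
qed

text \<open>The generating function of the non-root vertices of a tree of height less than \<open>h\<close>.\<close>

definition branch_egf :: "nat \<Rightarrow> real fps" where
  "branch_egf h = (case h of 0 \<Rightarrow> 0 | Suc h' \<Rightarrow> fps_exp 1 oo tree_egf h')"

lemma tree_egf_eq: "tree_egf h = fps_X * branch_egf h"
  by (cases h) (auto simp: branch_egf_def)

text \<open>Induction on the number of non-root vertices, removing the roots. The sum over parent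
  maps \<open>p\<close> is the power \<open>Y ^ card S\<close>; the sum over \<open>S\<close>,
  grouped by cardinality, is the exponential of \<open>fps_X * Y\<close>, which factors over the
  roots.\<close>

lemma card_forests:
  assumes "finite R" "finite N" "R \<inter> N = {}"
  shows "real (card (forests b R N)) = fact (card N) * (\<Prod>r\<in>R. branch_egf (b r)) $ card N"
  using assms
proof (induction "card N" arbitrary: b R N rule: less_induct)
  case less
  note fin = less.prems(1,2)
  show ?case
  proof (cases "\<exists>r\<in>R. b r = 0")
    case True
    then obtain r where r: "r \<in> R" "b r = 0" by blast
    then have "tree_level f N r (b r) \<noteq> {}" for f by simp
    with r(1) have "forests b R N = {}" unfolding forests_def by blast
    moreover have "(\<Prod>r\<in>R. branch_egf (b r)) = 0"
      by (rule prod_zero[OF fin(1)], rule bexI[OF _ r(1)]) (simp add: r(2) branch_egf_def)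
    ultimately show ?thesis by simp
  next
    case False
    then have b: "b r > 0" if "r \<in> R" for r using that by auto
    show ?thesis
    proof (cases "N = {}")
      case True
      have "tree_level f {} r (b r) = {}" if "r \<in> R" for f r
        using b[OF that] by (cases "b r") auto
      then have "forests b R N = {\<lambda>_. undefined}"
        using True by (auto simp: forests_def all_forests_def)
      moreover have "(\<Prod>r\<in>R. branch_egf (b r)) $ 0 = 1"
        using fin(1) b
      proof (induction R)
        case (insert r R)
        then have "b r > 0" by blast
        then have "branch_egf (b r) $ 0 = 1"
          by (cases "b r") (auto simp: branch_egf_def)
        with insert show ?case by simp
      qed simp
      ultimately show ?thesis using True by simp
    next
      case N: False
      define n where "n = card N"
      define Y where "Y = (\<Sum>r\<in>R. branch_egf (b r - 1))"
      have IH: "real (card (forests (\<lambda>s. b (p s) - 1) S (N - S))) =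
          fact (n - card S) * (\<Prod>s\<in>S. branch_egf (b (p s) - 1)) $ (n - card S)"
        if S: "S \<subseteq> N" for S p
      proof (cases "S = {}")
        case True
        \<comment> \<open>Without children of roots no vertex of the non-empty \<open>N\<close> is
          reached; the right-hand side vanishes as well, being a coefficient of \<open>1\<close> at
          degree \<open>n > 0\<close>.\<close>
        have "forests (\<lambda>s. b (p s) - 1) S (N - S) = {}"
          using True N by (auto simp: forests_def all_forests_def)
        moreover have "n > 0" using N fin by (simp add: n_def card_gt_0_iff)
        ultimately show ?thesis using True by simp
      next
        case False
        have finS: "finite S" using S fin finite_subset by blast
        then have card: "card (N - S) = n - card S" 
          using S by (simp add: n_def card_Diff_subset)
        have "card (N - S) < card N"
          using S False fin by (intro psubset_card_mono) auto
        then show ?thesis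
          using less.hyps[of "N - S" S "\<lambda>s. b (p s) - 1"] finS fin by (simp add: card)
      qed
      have "real (card (forests b R N)) = (\<Sum>S\<in>Pow N. \<Sum>p\<in>S \<rightarrow>\<^sub>E R.
          fact (n - card S) * (\<Prod>s\<in>S. branch_egf (b (p s) - 1)) $ (n - card S))"
        by (subst card_forests_rec[OF less.prems], erule b, unfold of_nat_sum, intro sum.cong refl IH) auto
      also have "\<dots> = (\<Sum>S\<in>Pow N. fact (n - card S) * (Y ^ card S) $ (n - card S))"
      proof (intro sum.cong refl)
        fix S assume "S \<in> Pow N"
        then have "finite S" using fin finite_subset by blast
        show "(\<Sum>p\<in>S \<rightarrow>\<^sub>E R. fact (n - card S) * (\<Prod>s\<in>S. branch_egf (b (p s) - 1)) $ (n - card S)) =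
            fact (n - card S) * (Y ^ card S) $ (n - card S)"
          unfolding Y_def sum_PiE_prod_eq_power[OF \<open>finite S\<close> fin(1), symmetric]
          by (simp add: fps_sum_nth sum_distrib_left)
      qed
      also have "\<dots> = (\<Sum>s\<le>n. real (n choose s) * (fact (n - s) * (Y ^ s) $ (n - s)))"
        unfolding n_def using fin by (subst sum_Pow_card[symmetric]) auto
      also have "\<dots> = (\<Sum>s\<le>n. fact n * (1 / fact s * ((fps_X * Y) ^ s) $ n))"
        by (intro sum.cong refl) (simp add: binomial_fact power_mult_distrib fps_X_power_mult_nth)
      also have "\<dots> = fact n * (fps_exp 1 oo (fps_X * Y)) $ n"
        by (simp add: fps_compose_nth atLeast0AtMost sum_distrib_left)
      also have "fps_X * Y = (\<Sum>r\<in>R. tree_egf (b r - 1))"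
        by (simp add: Y_def sum_distrib_left tree_egf_eq)
      also have "fps_exp 1 oo \<dots> = (\<Prod>r\<in>R. fps_exp 1 oo tree_egf (b r - 1))"
        by (rule fps_exp_compose_sum) (use fin in auto)
      also have "\<dots> = (\<Prod>r\<in>R. branch_egf (b r))"
      proof (intro prod.cong refl)
        fix r assume "r \<in> R"
        then have "b r > 0" by (rule b)
        then show "fps_exp 1 oo tree_egf (b r - 1) = branch_egf (b r)"
          by (cases "b r") (auto simp: branch_egf_def)
      qed
      finally show ?thesis by (simp add: n_def)
    qed
  qed
qed

section \<open>Mappings\<close>

lemma finite_cycle_core [simp]: "finite (cycle_core n g)"
  by (simp add: cycle_core_def)

lemma cycle_core_subset: "cycle_core n g \<subseteq> {1..n}"
  by (auto simp: cycle_core_def)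

lemma mapping_funpow:
  assumes "g \<in> mappings n" "y \<in> {1..n}"
  shows "(g ^^ k) y \<in> {1..n}"
  using assms by (induction k) (auto simp: mappings_def PiE_iff)

lemma cycle_core_closed:
  assumes "g \<in> mappings n" "x \<in> cycle_core n g"
  shows "g x \<in> cycle_core n g"
proof -
  from assms(2) obtain k where k: "k \<ge> 1" "(g ^^ k) x = x" and x: "x \<in> {1..n}"
    by (auto simp: cycle_core_def)
  have "(g ^^ k) (g x) = g x"
    using k by (simp add: funpow_swap1[symmetric])
  moreover have "g x \<in> {1..n}" using mapping_funpow[OF assms(1) x, of 1] by simp
  ultimately show ?thesis using k by (auto simp: cycle_core_def)
qed

lemma funpow_fixed: "(f ^^ m) x = x \<Longrightarrow> (f ^^ (m * k)) x = x"
  by (induction k) (simp_all add: funpow_add)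

text \<open>If \<open>a\<close> and \<open>b\<close> are periods of \<open>x\<close> and
  \<open>y\<close>, then \<open>g ^^ (a * b)\<close> fixes both, and its values there depend only on
  \<open>g x = g y\<close>.\<close>

lemma inj_on_cycle_core: "inj_on g (cycle_core n g)"
proof (rule inj_onI)
  fix x y assume x: "x \<in> cycle_core n g" and y: "y \<in> cycle_core n g" and eq: "g x = g y"
  obtain a b where a: "a \<ge> 1" "(g ^^ a) x = x" and b: "b \<ge> 1" "(g ^^ b) y = y"
    using x y by (auto simp: cycle_core_def)
  obtain m where m: "a * b = Suc m" using a b by (cases "a * b") auto
  have "x = (g ^^ (a * b)) x" using funpow_fixed[OF a(2)] by simp
  also have "\<dots> = (g ^^ m) (g x)" unfolding m by (simp add: funpow_swap1)
  also have "\<dots> = (g ^^ (b * a)) y" unfolding eq mult.commute[of b] m by (simp add: funpow_swap1)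
  also have "\<dots> = y" using funpow_fixed[OF b(2)] by simp
  finally show "x = y" .
qed

text \<open>By the pigeonhole principle two of the first \<open>n + 1\<close> iterates coincide, and
  the earlier one is cyclic.\<close>

lemma reaches_cycle_core:
  assumes g: "g \<in> mappings n" and y: "y \<in> {1..n}"
  shows "\<exists>k\<le>n. (g ^^ k) y \<in> cycle_core n g"
proof -
  have "card ((\<lambda>k. (g ^^ k) y) ` {..n}) \<le> card {1..n}"
    using mapping_funpow[OF g y] by (intro card_mono) auto
  then have "\<not> inj_on (\<lambda>k. (g ^^ k) y) {..n}"
    using card_image[of "\<lambda>k. (g ^^ k) y" "{..n}"] by auto
  then obtain i j where ij: "i < j" "j \<le> n" "(g ^^ i) y = (g ^^ j) y"
    unfolding inj_on_def by (metis atMost_iff linorder_neqE_nat)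
  then have "(g ^^ (j - i)) ((g ^^ i) y) = (g ^^ i) y"
    by (metis add.commute comp_apply funpow_add le_add_diff_inverse less_imp_le)
  moreover have "1 \<le> j - i" using ij by simp
  ultimately have "(g ^^ i) y \<in> cycle_core n g"
    using mapping_funpow[OF g y, of i] unfolding cycle_core_def by blast
  then show ?thesis using ij by (intro exI[of _ i]) auto
qed

lemma depth_le:
  assumes "g \<in> mappings n" "y \<in> {1..n}"
  shows "depth n g y \<le> n"
proof -
  obtain k where "k \<le> n" "(g ^^ k) y \<in> cycle_core n g"
    using reaches_cycle_core[OF assms] by blast
  then show ?thesis unfolding depth_def by (meson Least_le le_trans)
qed

lemma root_of_in_cycle_core:
  assumes "g \<in> mappings n" "y \<in> {1..n}"
  shows "root_of n g y \<in> cycle_core n g"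
proof -
  obtain k where "(g ^^ k) y \<in> cycle_core n g"
    using reaches_cycle_core[OF assms] by blast
  then show ?thesis unfolding depth_def root_of_def by (rule LeastI)
qed

lemma depth_cyclic: "y \<in> cycle_core n g \<Longrightarrow> depth n g y = 0"
  unfolding depth_def by (rule Least_eq_0) simp

lemma root_of_cyclic: "y \<in> cycle_core n g \<Longrightarrow> root_of n g y = y"
  by (simp add: root_of_def depth_cyclic)

lemma depth_Suc:
  assumes "g \<in> mappings n" "y \<in> {1..n} - cycle_core n g"
  shows "depth n g y = Suc (depth n g (g y))"
proof -
  obtain k where "(g ^^ k) y \<in> cycle_core n g"
    using reaches_cycle_core assms by blast
  then have "depth n g y = Suc (LEAST m. (g ^^ Suc m) y \<in> cycle_core n g)"
    unfolding depth_def using assms by (intro Least_Suc) auto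
  then show ?thesis by (simp add: depth_def funpow_swap1)
qed

lemma root_of_Suc:
  assumes "g \<in> mappings n" "y \<in> {1..n} - cycle_core n g"
  shows "root_of n g y = root_of n g (g y)"
  by (simp add: root_of_def depth_Suc[OF assms] funpow_swap1)

section \<open>The trees of a mapping as a forest rooted in its cycle core\<close>

lemma tree_level_iff:
  assumes g: "g \<in> mappings n" and x: "x \<in> cycle_core n g"
  shows "y \<in> tree_level g ({1..n} - cycle_core n g) x k \<longleftrightarrow>
    y \<in> {1..n} \<and> depth n g y = k \<and> root_of n g y = x"
proof (induction k arbitrary: y)
  case 0
  show ?case
  proof
    assume "y \<in> {1..n} \<and> depth n g y = 0 \<and> root_of n g y = x"
    then show "y \<in> tree_level g ({1..n} - cycle_core n g) x 0"
      by (auto simp: root_of_def)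
  qed (use x cycle_core_subset[of n g] in \<open>auto simp: depth_cyclic root_of_cyclic\<close>)
next
  case (Suc k)
  have y: "g y \<in> {1..n}" if "y \<in> {1..n}"
    using mapping_funpow[OF g that, of 1] by simp
  show ?case
  proof (cases "y \<in> cycle_core n g")
    case True
    then show ?thesis by (simp add: depth_cyclic)
  next
    case False
    show ?thesis
    proof (cases "y \<in> {1..n}")
      case True
      with False have yN: "y \<in> {1..n} - cycle_core n g" by blast
      then have "y \<in> tree_level g ({1..n} - cycle_core n g) x (Suc k) \<longleftrightarrow>
          g y \<in> tree_level g ({1..n} - cycle_core n g) x k" by simp
      also have "\<dots> \<longleftrightarrow> depth n g (g y) = k \<and> root_of n g (g y) = x"
        using Suc y[OF True] by simp
      finally show ?thesis
        using True by (simp add: depth_Suc[OF g yN] root_of_Suc[OF g yN])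
    qed auto
  qed
qed

lemma tree_level_empty_mono:
  "tree_level f N r h = {} \<Longrightarrow> h \<le> k \<Longrightarrow> tree_level f N r k = {}"
  by (induction k rule: nat_induct) (auto simp: le_Suc_eq)

text \<open>After an empty level all later ones are empty, so level \<open>h\<close> alone decides;
  this is the condition used in \<open>forests\<close>.\<close>

lemma tree_height_less_iff:
  assumes g: "g \<in> mappings n" and x: "x \<in> cycle_core n g"
  shows "tree_height n g x < h \<longleftrightarrow> tree_level g ({1..n} - cycle_core n g) x h = {}"
proof -
  have "x \<in> tree_at n g x"
    using x cycle_core_subset[of n g] root_of_cyclic[OF x] unfolding tree_at_def by blast
  then have "finite (depth n g ` tree_at n g x)" "depth n g ` tree_at n g x \<noteq> {}"
    by (auto simp: tree_at_def)
  then have "tree_height n g x < h \<longleftrightarrow> (\<forall>y\<in>tree_at n g x. depth n g y < h)"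
    unfolding tree_height_def by (subst Max_less_iff) auto
  also have "\<dots> \<longleftrightarrow> (\<forall>k\<ge>h. tree_level g ({1..n} - cycle_core n g) x k = {})"
  proof
    assume "\<forall>y\<in>tree_at n g x. depth n g y < h"
    then show "\<forall>k\<ge>h. tree_level g ({1..n} - cycle_core n g) x k = {}"
      using tree_level_iff[OF g x] unfolding tree_at_def by fastforce
  next
    assume *: "\<forall>k\<ge>h. tree_level g ({1..n} - cycle_core n g) x k = {}"
    show "\<forall>y\<in>tree_at n g x. depth n g y < h"
    proof (rule ballI, rule ccontr)
      fix y assume y: "y \<in> tree_at n g x" "\<not> depth n g y < h"
      then have "y \<in> tree_level g ({1..n} - cycle_core n g) x (depth n g y)"
        unfolding tree_level_iff[OF g x] by (simp add: tree_at_def)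
      with * y(2) show False by (metis empty_iff not_less)
    qed
  qed
  also have "\<dots> \<longleftrightarrow> tree_level g ({1..n} - cycle_core n g) x h = {}"
    by (meson order_refl tree_level_empty_mono)
  finally show ?thesis .
qed

lemma tree_height_le:
  assumes "g \<in> mappings n" "x \<in> cycle_core n g"
  shows "tree_height n g x \<le> n"
proof -
  have "tree_level g ({1..n} - cycle_core n g) x (Suc n) = {}"
  proof (rule equals0I)
    fix y assume "y \<in> tree_level g ({1..n} - cycle_core n g) x (Suc n)"
    then show False
      unfolding tree_level_iff[OF assms] using depth_le[OF assms(1), of y] by linarith
  qed
  then show ?thesis using tree_height_less_iff[OF assms, of "Suc n"] by simp
qed

lemma restrict_mem_all_forests:
  assumes g: "g \<in> mappings n"
  defines "N \<equiv> {1..n} - cycle_core n g"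
  shows "restrict g N \<in> all_forests (cycle_core n g) N"
proof -
  have level: "tree_level (restrict g N) N x k = tree_level g N x k" for x k
    by (rule tree_level_cong) auto
  have "y \<in> tree_level g N (root_of n g y) (depth n g y)" if "y \<in> N" for y
    using tree_level_iff[OF g root_of_in_cycle_core[OF g]] that unfolding N_def by auto
  then have "N \<subseteq> (\<Union>r\<in>cycle_core n g. \<Union>k. tree_level g N r k)"
    using root_of_in_cycle_core[OF g] unfolding N_def by blast
  moreover have "g y \<in> cycle_core n g \<union> N" if "y \<in> N" for y
    using mapping_funpow[OF g, of y 1] that by (auto simp: N_def)
  ultimately show ?thesis
    by (auto simp: all_forests_def level)
qed

lemma restrict_mem_forests_iff:
  assumes g: "g \<in> mappings n"
  defines "N \<equiv> {1..n} - cycle_core n g"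
  shows "restrict g N \<in> forests b (cycle_core n g) N \<longleftrightarrow>
    (\<forall>x\<in>cycle_core n g. tree_height n g x < b x)"
proof -
  have level: "tree_level (restrict g N) N x k = tree_level g N x k" for x k
    by (rule tree_level_cong) auto
  show ?thesis
    using restrict_mem_all_forests[OF g, folded N_def] tree_height_less_iff[OF g, folded N_def]
    by (simp add: forests_def level)
qed

text \<open>The tree at \<open>x\<close> has height exactly \<open>h\<close> and all others are
  lower. As a difference of two sets of \<open>forests\<close> it can be counted by
  \<open>card_forests\<close>.\<close>

definition highest_forests :: "'a \<Rightarrow> nat \<Rightarrow> 'a set \<Rightarrow> 'a set \<Rightarrow> ('a \<Rightarrow> 'a) set" where
  "highest_forests x h R N = forests (\<lambda>r. if r = x then Suc h else h) R N - forests (\<lambda>_. h) R N"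

lemma restrict_mem_highest_forests_iff:
  assumes g: "g \<in> mappings n" and x: "x \<in> cycle_core n g"
  defines "N \<equiv> {1..n} - cycle_core n g"
  shows "restrict g N \<in> highest_forests x h (cycle_core n g) N \<longleftrightarrow>
    tree_height n g x = h \<and> (\<forall>r\<in>cycle_core n g - {x}. tree_height n g r < h)"
  unfolding highest_forests_def Diff_iff N_def restrict_mem_forests_iff[OF g]
  using x by (auto simp: less_Suc_eq)

text \<open>Strict domination by one root replaces the maximum; this is the form that
  \<open>highest_forests\<close> captures.\<close>

lemma unique_highest_tree_iff:
  assumes "n \<ge> 1" "g \<in> mappings n"
  shows "unique_highest_tree n g \<longleftrightarrow>
    (\<exists>x\<in>cycle_core n g. \<forall>r\<in>cycle_core n g - {x}. tree_height n g r < tree_height n g x)"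
proof -
  let ?C = "cycle_core n g" and ?H = "tree_height n g"
  have "?C \<noteq> {}"
    using reaches_cycle_core[OF assms(2), of 1] assms(1) by auto
  then have fin: "finite (?H ` ?C)" "?H ` ?C \<noteq> {}" by auto
  have max: "?H r \<le> Max (?H ` ?C)" if "r \<in> ?C" for r
    using that fin by auto
  show ?thesis
  proof
    assume "unique_highest_tree n g"
    then obtain x where x: "x \<in> ?C" "?H x = Max (?H ` ?C)"
      and u: "\<And>r. r \<in> ?C \<Longrightarrow> ?H r = Max (?H ` ?C) \<Longrightarrow> r = x"
      unfolding unique_highest_tree_def by blast
    show "\<exists>x\<in>?C. \<forall>r\<in>?C - {x}. ?H r < ?H x"
    proof (rule bexI[OF _ x(1)], rule ballI)
      fix r assume "r \<in> ?C - {x}"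
      then have r: "r \<in> ?C" "r \<noteq> x" by auto
      then have "?H r \<noteq> Max (?H ` ?C)" using u[OF r(1)] by blast
      then show "?H r < ?H x" using max[OF r(1)] x(2) by simp
    qed
  next
    assume "\<exists>x\<in>?C. \<forall>r\<in>?C - {x}. ?H r < ?H x"
    then obtain x where x: "x \<in> ?C" "\<And>r. r \<in> ?C - {x} \<Longrightarrow> ?H r < ?H x" by blast
    have "Max (?H ` ?C) = ?H x"
    proof (rule Max_eqI)
      fix h assume "h \<in> ?H ` ?C"
      then obtain r where "r \<in> ?C" "h = ?H r" by blast
      then show "h \<le> ?H x" using x(2)[of r] by (cases "r = x") auto
    qed (use x in auto)
    then show "unique_highest_tree n g"
      unfolding unique_highest_tree_def
    proof (intro ex1I[of _ x] conjI)
      fix r assume r: "r \<in> ?C \<and> ?H r = Max (?H ` ?C)"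
      show "r = x"
        using x(2)[of r] r \<open>Max (?H ` ?C) = ?H x\<close> by (cases "r = x") auto
    qed (use x in auto)
  qed
qed

text \<open>No vertex outside \<open>C\<close> becomes cyclic: its orbit enters \<open>C\<close>
  after as many steps as its level says and then stays there.\<close>

lemma cycle_core_glue:
  assumes C: "C \<subseteq> {1..n}" and p: "p permutes C" and f: "f \<in> all_forests C ({1..n} - C)"
  defines "g \<equiv> \<lambda>y. if y \<in> C then p y else f y"
  shows "g \<in> mappings n" "cycle_core n g = C"
proof -
  define N where "N = {1..n} - C"
  have fN: "f \<in> N \<rightarrow>\<^sub>E C \<union> N" and cover: "N \<subseteq> (\<Union>r\<in>C. \<Union>k. tree_level f N r k)"
    using f by (auto simp: all_forests_def N_def)
  have pC: "p y \<in> C" if "y \<in> C" for y using that p permutes_in_image by metis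
  have "g y \<in> {1..n}" if "y \<in> {1..n}" for y
  proof (cases "y \<in> C")
    case True
    then have "p y \<in> {1..n}" using pC C by blast
    then show ?thesis using True by (simp add: g_def)
  next
    case False
    then have "f y \<in> C \<union> N" using that fN by (auto simp: N_def PiE_iff)
    then show ?thesis using False C by (auto simp: g_def N_def)
  qed
  moreover have "g y = undefined" if "y \<notin> {1..n}" for y
    using that C fN by (auto simp: g_def N_def PiE_iff extensional_def)
  ultimately show "g \<in> mappings n"
    by (auto simp: mappings_def PiE_iff extensional_def)
  have gC: "(g ^^ k) y \<in> C" "(g ^^ k) y = (p ^^ k) y" if "y \<in> C" for k y
    using that by (induction k) (auto simp: g_def pC)
  have "C \<subseteq> cycle_core n g"
  proof
    fix y assume y: "y \<in> C"
    have "finite {z. \<exists>k. z = (p ^^ k) y}"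
      by (rule finite_subset[of _ C]) (use gC[OF y] finite_subset[OF C] in auto)
    then obtain k where "k > 0" "(p ^^ k) y = y"
      using funpow_inj_finite[OF permutes_inj[OF p]] by blast
    then show "y \<in> cycle_core n g"
      using y C gC(2)[OF y, of k] by (auto simp: cycle_core_def Suc_le_eq)
  qed
  moreover have "cycle_core n g \<subseteq> C"
  proof (rule ccontr)
    assume "\<not> cycle_core n g \<subseteq> C"
    then obtain y m where y: "y \<in> N" and m: "m \<ge> 1" "(g ^^ m) y = y"
      by (auto simp: cycle_core_def N_def)
    from y cover obtain r k where r: "r \<in> C" "y \<in> tree_level f N r k" by blast
    have "(g ^^ k) z \<in> C" if "z \<in> tree_level f N r k" for z
      using that
    proof (induction k arbitrary: z)
      case (Suc k)
      then have IH: "(g ^^ k) (f z) \<in> C" and "z \<in> N" by auto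
      then have "g z = f z" by (simp add: g_def N_def)
      then have "(g ^^ Suc k) z = (g ^^ k) (f z)" by (simp add: funpow_swap1)
      with IH show ?case by (simp only:)
    qed (use r in simp)
    then have "(g ^^ k) y \<in> C" using r(2) by blast
    \<comment> \<open>At time \<open>m * k\<close>, a multiple of the period and not before
      \<open>k\<close>, the orbit would be in \<open>C\<close> and also back at
      \<open>y\<close>.\<close>
    then have "(g ^^ (m * k - k)) ((g ^^ k) y) \<in> C" by (rule gC(1))
    moreover have "m * k - k + k = m * k" using m by simp
    ultimately have "(g ^^ (m * k)) y \<in> C"
      by (metis comp_apply funpow_add)
    then show False using funpow_fixed[OF m(2)] y by (simp add: N_def)
  qed
  ultimately show "cycle_core n g = C" by blast
qed

text \<open>On the core a mapping is an arbitrary permutation, chosen independently of the forest;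
  this gives the factor \<open>fact (card C)\<close>.\<close>

lemma card_mappings_forests:
  assumes C: "C \<subseteq> {1..n}" and F: "F \<subseteq> all_forests C ({1..n} - C)"
  shows "card {g \<in> mappings n. cycle_core n g = C \<and> restrict g ({1..n} - C) \<in> F} =
    fact (card C) * card F"
proof -
  let ?N = "{1..n} - C"
  let ?h = "\<lambda>(p, f) y. if y \<in> C then p y else f y"
  have finC: "finite C" using C finite_subset by blast
  have "bij_betw ?h ({p. p permutes C} \<times> F)
      {g \<in> mappings n. cycle_core n g = C \<and> restrict g ?N \<in> F}"
  \<comment> \<open>\<open>permutes\<close> requires the identity outside \<open>C\<close>, so the
    inverse replaces \<open>g\<close> by the identity there.\<close>
  proof (rule bij_betw_byWitness[where f' = "\<lambda>g. (\<lambda>y. if y \<in> C then g y else y, restrict g ?N)"])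
    have res: "restrict (?h (p, f)) ?N = f" if "f \<in> F" for p f
    proof -
      have "f \<in> extensional ?N" using that F by (auto simp: all_forests_def PiE_def)
      then show ?thesis by (auto simp: fun_eq_iff restrict_def extensional_def)
    qed
    show "\<forall>a\<in>{p. p permutes C} \<times> F. (\<lambda>y. if y \<in> C then ?h a y else y, restrict (?h a) ?N) = a"
    proof (rule ballI)
      fix a assume "a \<in> {p. p permutes C} \<times> F"
      then obtain p f where a: "a = (p, f)" "p permutes C" "f \<in> F" by blast
      then have "(\<lambda>y. if y \<in> C then ?h a y else y) = p"
        by (auto simp: fun_eq_iff permutes_not_in)
      then show "(\<lambda>y. if y \<in> C then ?h a y else y, restrict (?h a) ?N) = a"
        using res[OF a(3)] a(1) by (simp only:)
    qed
    show "\<forall>g\<in>{g \<in> mappings n. cycle_core n g = C \<and> restrict g ?N \<in> F}.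
        ?h (\<lambda>y. if y \<in> C then g y else y, restrict g ?N) = g"
      using C by (auto simp: fun_eq_iff mappings_def PiE_iff extensional_def)
    show "?h ` ({p. p permutes C} \<times> F) \<subseteq> {g \<in> mappings n. cycle_core n g = C \<and> restrict g ?N \<in> F}"
    proof (rule image_subsetI)
      fix a assume "a \<in> {p. p permutes C} \<times> F"
      then obtain p f where a: "a = (p, f)" and p: "p permutes C" and f: "f \<in> F" by blast
      have "?h a \<in> mappings n" "cycle_core n (?h a) = C"
        unfolding a prod.case using cycle_core_glue[OF C p] F f by blast+
      moreover have "restrict (?h a) ?N \<in> F"
        using res[OF f, of p] f unfolding a by (simp only:)
      ultimately show "?h a \<in> {g \<in> mappings n. cycle_core n g = C \<and> restrict g ?N \<in> F}"
        by blast
    qed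
    show "(\<lambda>g. (\<lambda>y. if y \<in> C then g y else y, restrict g ?N)) `
        {g \<in> mappings n. cycle_core n g = C \<and> restrict g ?N \<in> F} \<subseteq> {p. p permutes C} \<times> F"
    proof (rule image_subsetI)
      fix g assume "g \<in> {g \<in> mappings n. cycle_core n g = C \<and> restrict g ?N \<in> F}"
      then have g: "g \<in> mappings n" "C = cycle_core n g" "restrict g ?N \<in> F" by auto
      have "inj_on g C" "g ` C \<subseteq> C"
        using inj_on_cycle_core cycle_core_closed[OF g(1)] unfolding g(2) by auto
      then have "bij_betw g C C"
        using finC by (simp add: bij_betw_def endo_inj_surj)
      then have "bij_betw (\<lambda>y. if y \<in> C then g y else y) C C"
        by (simp cong: bij_betw_cong)
      then have "(\<lambda>y. if y \<in> C then g y else y) permutes C"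
        by (rule bij_imp_permutes) simp
      then show "(\<lambda>y. if y \<in> C then g y else y, restrict g ?N) \<in> {p. p permutes C} \<times> F"
        using g(3) by blast
    qed
  qed
  from bij_betw_same_card[OF this] show ?thesis
    using finC by (simp add: card_cartesian_product card_permutations)
qed

section \<open>Counting the mappings with a unique highest tree\<close>

lemma card_unique_highest:
  assumes n: "n \<ge> 1"
  shows "card {g \<in> mappings n. unique_highest_tree n g} =
    (\<Sum>C\<in>Pow {1..n}. \<Sum>x\<in>C. \<Sum>h\<le>n. fact (card C) * card (highest_forests x h C ({1..n} - C)))"
proof -
  let ?I = "SIGMA C:Pow {1..n}. C \<times> {..n}"
  let ?U = "\<lambda>(C, x, h). {g \<in> mappings n. cycle_core n g = C \<and> restrict g ({1..n} - C) \<in> highest_forests x h C ({1..n} - C)}"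
  have finC: "finite C" if "C \<in> Pow {1..n}" for C
    using that finite_subset by blast
  have finM: "finite (mappings n)"
    by (simp add: mappings_def finite_PiE)
  have mem: "g \<in> ?U (C, x, h) \<longleftrightarrow> g \<in> mappings n \<and> cycle_core n g = C \<and> tree_height n g x = h \<and>
      (\<forall>r\<in>cycle_core n g - {x}. tree_height n g r < h)" if "x \<in> C" for g C x h
    using restrict_mem_highest_forests_iff[of g n x h] that by auto
  \<comment> \<open>The mappings are sorted by their core \<open>C\<close>, the root
    \<open>x\<close> of the highest tree and its height \<open>h\<close>, which is at most
    \<open>n\<close>.\<close>
  have eq: "{g \<in> mappings n. unique_highest_tree n g} = (\<Union>i\<in>?I. ?U i)"
  proof (intro equalityI subsetI)
    fix g assume "g \<in> {g \<in> mappings n. unique_highest_tree n g}"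
    then obtain x where g: "g \<in> mappings n" and x: "x \<in> cycle_core n g"
      and "\<forall>r\<in>cycle_core n g - {x}. tree_height n g r < tree_height n g x"
      using unique_highest_tree_iff[OF n] by blast
    then have "g \<in> ?U (cycle_core n g, x, tree_height n g x)"
      unfolding mem[OF x] by blast
    moreover have "(cycle_core n g, x, tree_height n g x) \<in> ?I"
      using x tree_height_le[OF g x] cycle_core_subset[of n g] by auto
    ultimately show "g \<in> (\<Union>i\<in>?I. ?U i)" by blast
  next
    fix g assume "g \<in> (\<Union>i\<in>?I. ?U i)"
    then obtain C x h where "x \<in> C" "g \<in> ?U (C, x, h)" by blast
    then show "g \<in> {g \<in> mappings n. unique_highest_tree n g}"
      unfolding mem[OF \<open>x \<in> C\<close>] using unique_highest_tree_iff[OF n] by blast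
  qed
  have "card {g \<in> mappings n. unique_highest_tree n g} = (\<Sum>i\<in>?I. card (?U i))"
    unfolding eq
  proof (rule card_UN_disjoint)
    show "finite ?I" using finC by auto
    show "\<forall>i\<in>?I. finite (?U i)" using finM by auto
    show "\<forall>i\<in>?I. \<forall>j\<in>?I. i \<noteq> j \<longrightarrow> ?U i \<inter> ?U j = {}"
    proof (intro ballI impI, rule ccontr)
      fix i j assume ij: "i \<in> ?I" "j \<in> ?I" "i \<noteq> j" and "?U i \<inter> ?U j \<noteq> {}"
      obtain C x h C' x' h' where i: "i = (C, x, h)" and j: "j = (C', x', h')"
        by (cases i, cases j) auto
      have xC: "x \<in> C" "x' \<in> C'" using ij i j by auto
      from \<open>?U i \<inter> ?U j \<noteq> {}\<close> obtain g where "g \<in> ?U (C, x, h)" "g \<in> ?U (C', x', h')"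
        unfolding i j by blast
      then have g: "cycle_core n g = C" "tree_height n g x = h" "\<forall>r\<in>cycle_core n g - {x}. tree_height n g r < h"
        "cycle_core n g = C'" "tree_height n g x' = h'" "\<forall>r\<in>cycle_core n g - {x'}. tree_height n g r < h'"
        unfolding mem[OF xC(1)] mem[OF xC(2)] by blast+
      \<comment> \<open>Otherwise each of the two trees would be strictly higher than the
        other.\<close>
      have "x = x'"
      proof (rule ccontr)
        assume "x \<noteq> x'"
        then have "x' \<in> cycle_core n g - {x}" "x \<in> cycle_core n g - {x'}" using g xC by auto
        then show False using g by (meson less_asym)
      qed
      then show False using g ij i j by simp
    qed
  qed
  also have "\<dots> = (\<Sum>(C, x, h)\<in>?I. fact (card C) * card (highest_forests x h C ({1..n} - C)))"
  proof (intro sum.cong refl)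
    fix i assume "i \<in> ?I"
    then obtain C x h where i: "i = (C, x, h)" and C: "C \<subseteq> {1..n}" by auto
    have "highest_forests x h C ({1..n} - C) \<subseteq> all_forests C ({1..n} - C)"
      by (auto simp: highest_forests_def forests_def)
    from card_mappings_forests[OF C this]
    show "card (?U i) = (case i of (C, x, h) \<Rightarrow> fact (card C) * card (highest_forests x h C ({1..n} - C)))"
      by (simp add: i)
  qed
  also have "\<dots> = (\<Sum>C\<in>Pow {1..n}. \<Sum>(x, h)\<in>C \<times> {..n}. fact (card C) * card (highest_forests x h C ({1..n} - C)))"
    using finC by (subst sum.Sigma) (auto intro: sum.cong)
  also have "\<dots> = (\<Sum>C\<in>Pow {1..n}. \<Sum>x\<in>C. \<Sum>h\<le>n. fact (card C) * card (highest_forests x h C ({1..n} - C)))"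
    by (simp add: sum.cartesian_product)
  finally show ?thesis .
qed

text \<open>One set of forests contains the other, so cardinalities subtract; the two products over
  the roots differ only in the factor at \<open>x\<close>.\<close>

lemma card_highest_forests:
  assumes "finite R" "finite N" "R \<inter> N = {}" "x \<in> R"
  shows "real (card (highest_forests x h R N)) =
    fact (card N) * ((branch_egf (Suc h) - branch_egf h) * branch_egf h ^ (card R - 1)) $ card N"
proof -
  have "forests (\<lambda>_. h) R N \<subseteq> forests (\<lambda>r. if r = x then Suc h else h) R N"
    using tree_level_empty_mono[of _ N _ h "Suc h"] by (auto simp: forests_def simp del: tree_level.simps)
  then have "real (card (highest_forests x h R N)) =
      real (card (forests (\<lambda>r. if r = x then Suc h else h) R N)) - real (card (forests (\<lambda>_. h) R N))"
    unfolding highest_forests_def using assms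
    by (subst card_Diff_subset) (auto intro!: of_nat_diff card_mono finite_forests)
  also have "(\<Prod>r\<in>R. branch_egf (if r = x then Suc h else h)) = branch_egf (Suc h) * branch_egf h ^ (card R - 1)"
  proof -
    have "(\<Prod>r\<in>R. branch_egf (if r = x then Suc h else h)) =
        branch_egf (Suc h) * (\<Prod>r\<in>R - {x}. branch_egf (if r = x then Suc h else h))"
      using assms by (simp add: prod.remove[OF assms(1,4)])
    also have "(\<Prod>r\<in>R - {x}. branch_egf (if r = x then Suc h else h)) = (\<Prod>r\<in>R - {x}. branch_egf h)"
      by (intro prod.cong) auto
    finally show ?thesis using assms by simp
  qed
  moreover have "(\<Prod>r\<in>R. branch_egf h) = branch_egf h * branch_egf h ^ (card R - 1)"
    using assms by (simp add: power_eq_if[of _ "card R"] card_eq_0_iff) auto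
  ultimately show ?thesis
    unfolding card_forests[OF assms(1-3)] by (simp add: algebra_simps)
qed

text \<open>The coefficient \<open>Suc k\<close> will be the number of choices of the highest root
  among \<open>k + 1\<close> cyclic vertices.\<close>

lemma seq_egf_square:
  "seq_egf h ^ 2 = Abs_fps (\<lambda>k. real (Suc k)) oo tree_egf h"
proof -
  have "fps_geom ^ 2 = Abs_fps (\<lambda>k. real (Suc k))"
    by (rule fps_ext) (simp add: fps_geom_def power2_eq_square fps_mult_nth)
  then show ?thesis
    by (simp add: seq_egf_def fps_compose_power)
qed

text \<open>For \<open>k\<close> cyclic vertices there are \<open>k\<close> choices of
  \<open>x\<close>, and \<open>(n choose k) * k! * (n - k)! = n!\<close>; the rest sums to
  \<open>D_h U_h^2\<close>. The truncation is at \<open>Suc n\<close> because \<open>h\<close> runs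
  up to \<open>n\<close>.\<close>

lemma card_unique_highest_eq:
  assumes n: "n \<ge> 1"
  shows "real (card {g \<in> mappings n. unique_highest_tree n g}) = fact n * unique_egf (Suc n) $ n"
proof -
  define B where "B = (\<lambda>h k. ((branch_egf (Suc h) - branch_egf h) * branch_egf h ^ (k - 1)) $ (n - k))"
  have "real (card {g \<in> mappings n. unique_highest_tree n g}) =
      (\<Sum>C\<in>Pow {1..n}. \<Sum>x\<in>C. \<Sum>h\<le>n. fact (card C) * (fact (n - card C) * B h (card C)))"
    unfolding card_unique_highest[OF n] of_nat_sum
  proof (intro sum.cong refl)
    fix C x h assume C: "C \<in> Pow {1..n}" and x: "x \<in> C"
    have fin: "finite C" using C finite_subset by blast
    have "card ({1..n} - C) = n - card C" using C fin by (simp add: card_Diff_subset)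
    then show "real (fact (card C) * card (highest_forests x h C ({1..n} - C))) =
        fact (card C) * (fact (n - card C) * B h (card C))"
      using card_highest_forests[of C "{1..n} - C" x h] fin x by (simp add: B_def)
  qed
  also have "\<dots> = (\<Sum>C\<in>Pow {1..n}. real (card C) * (\<Sum>h\<le>n. fact (card C) * (fact (n - card C) * B h (card C))))"
    by simp
  also have "\<dots> = (\<Sum>k\<le>n. real (n choose k) * (real k * (\<Sum>h\<le>n. fact k * (fact (n - k) * B h k))))"
    using sum_Pow_card[of "{1..n}" "\<lambda>k. real k * (\<Sum>h\<le>n. fact k * (fact (n - k) * B h k))"] by simp
  also have "\<dots> = (\<Sum>k\<le>n. fact n * (\<Sum>h\<le>n. real k * B h k))"
    by (intro sum.cong refl) (simp add: binomial_fact sum_distrib_left)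
  also have "\<dots> = fact n * (\<Sum>k\<le>n. \<Sum>h\<le>n. real k * B h k)"
    by (simp add: sum_distrib_left)
  also have "(\<Sum>k\<le>n. \<Sum>h\<le>n. real k * B h k) = (\<Sum>h\<le>n. \<Sum>k\<le>n. real k * B h k)"
    by (rule sum.swap)
  also have "(\<Sum>h\<le>n. \<Sum>k\<le>n. real k * B h k) = (\<Sum>h\<le>n. (height_egf h * seq_egf h ^ 2) $ n)"
  proof (intro sum.cong refl)
    fix h
    obtain n' where n': "n = Suc n'" using n by (cases n) auto
    \<comment> \<open>The summand at \<open>k = 0\<close> vanishes by its factor, so the exponent
      \<open>k - 1\<close> in \<open>B\<close> is exact in all others.\<close>
    have "(\<Sum>k\<le>n. real k * B h k) = (\<Sum>k\<le>n'. real (Suc k) * (tree_egf h ^ k * height_egf h) $ n)"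
      unfolding n' sum.atMost_Suc_shift
    proof (simp del: of_nat_Suc tree_egf.simps, intro sum.cong refl)
      fix k assume k: "k \<in> {..n'}"
      have "tree_egf h ^ k * height_egf h =
          fps_X ^ Suc k * ((branch_egf (Suc h) - branch_egf h) * branch_egf h ^ k)"
        unfolding height_egf_def tree_egf_eq by (simp add: power_mult_distrib algebra_simps)
      then have "(tree_egf h ^ k * height_egf h) $ Suc n' = B h (Suc k)"
        using k n' by (simp add: B_def fps_X_power_mult_nth del: power_Suc)
      then show "real (Suc k) * B h (Suc k) = real (Suc k) * (tree_egf h ^ k * height_egf h) $ Suc n'"
        by simp
    qed
    also have "\<dots> = (\<Sum>k\<le>n. real (Suc k) * (tree_egf h ^ k * height_egf h) $ n)"
    proof -
      \<comment> \<open>The extra summand at \<open>k = n\<close> has lowest degree above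
        \<open>n\<close>; it completes the range needed for
        \<open>fps_compose_mult_nth\<close>.\<close>
      have "(tree_egf h ^ n * height_egf h) $ n = 0"
        unfolding fps_mult_nth
      proof (intro sum.neutral ballI)
        fix j assume "j \<in> {0..n}"
        then show "(tree_egf h ^ n) $ j * height_egf h $ (n - j) = 0"
          using startsby_zero_power_prefix[of "tree_egf h" n]
          by (cases "j = n") (auto simp: height_egf_nth_eq_0)
      qed
      then show ?thesis using n' by simp
    qed
    also have "\<dots> = (seq_egf h ^ 2 * height_egf h) $ n"
      unfolding seq_egf_square by (subst fps_compose_mult_nth[of _ n n]) auto
    finally show "(\<Sum>k\<le>n. real k * B h k) = (height_egf h * seq_egf h ^ 2) $ n"
      by (simp add: mult.commute)
  qed
  also have "\<dots> = unique_egf (Suc n) $ n"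
    by (simp add: unique_egf_def fps_sum_nth lessThan_Suc_atMost del: sum.lessThan_Suc)
  finally show ?thesis .
qed

section \<open>Passage to probabilities and the asymptotics\<close>

lemma unique_highest_prob_bound:
  assumes n: "n \<ge> 2"
  shows "\<bar>measure_pmf.prob (pmf_of_set (mappings n)) {g. unique_highest_tree n g}
      - (1 - sqrt (pi / 8) * real n powr (- 1 / 2))\<bar> \<le> 442 * real n powr (- 1)"
proof -
  define P where "P = measure_pmf.prob (pmf_of_set (mappings n)) {g. unique_highest_tree n g}"
  define q where "q = fact n / real n ^ n"
  define Q where "Q = (\<Sum>k=1..n. fall_ratio n k)"
  have card: "card (mappings n) = n ^ n"
    by (simp add: mappings_def card_PiE)
  have fin: "finite (mappings n)"
    by (simp add: mappings_def finite_PiE)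
  have "mappings n \<noteq> {}"
    using card n by auto
  then have "P = card (mappings n \<inter> {g. unique_highest_tree n g}) / card (mappings n)"
    unfolding P_def using fin by (simp add: measure_pmf_of_set)
  also have "mappings n \<inter> {g. unique_highest_tree n g} = {g \<in> mappings n. unique_highest_tree n g}"
    by blast
  also have "real (card \<dots>) = fact n * unique_egf (Suc n) $ n"
    using n by (intro card_unique_highest_eq) simp
  finally have P: "P = q * unique_egf (Suc n) $ n"
    by (simp add: card q_def)
  have q: "q > 0" using n by (simp add: q_def)
  \<comment> \<open>Multiplication by \<open>q\<close> turns a coefficient into a proportion among
    all \<open>n ^ n\<close> mappings; the logarithm becomes \<open>Q / n\<close>.\<close>
  have qs: "q * seq_egf (Suc n) $ n = 1"
    using n by (subst seq_egf_nth) (auto simp: q_def)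
  have ql: "q * (fps_log oo tree_egf (Suc n)) $ n = Q / real n"
  proof -
    have "q * (fps_log oo tree_egf (Suc n)) $ n = (\<Sum>k=1..n. q * (real n ^ (n - k) / (real n * fact (n - k))))"
      using n by (subst log_egf_nth) (auto simp: sum_distrib_left simp del: tree_egf.simps)
    also have "\<dots> = (\<Sum>k=1..n. fall_ratio n k / real n)"
    proof (intro sum.cong refl)
      fix k assume k: "k \<in> {1..n}"
      then have "real n ^ n = real n ^ k * real n ^ (n - k)"
        by (simp add: power_add[symmetric])
      then show "q * (real n ^ (n - k) / (real n * fact (n - k))) = fall_ratio n k / real n"
        using k n by (simp add: fall_ratio_eq q_def)
    qed
    finally show ?thesis by (simp add: Q_def sum_divide_distrib)
  qed
  have "q * \<bar>2 * (seq_egf (Suc n) $ n - unique_egf (Suc n) $ n) - (fps_log oo tree_egf (Suc n)) $ n\<bar>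
      \<le> q * (19 * (real n ^ n / (real n * fact n)))"
    using n q by (intro mult_left_mono unique_egf_nth_bounds) auto
  also have "\<dots> = 19 / real n"
    using n by (simp add: q_def)
  also have "q * \<bar>2 * (seq_egf (Suc n) $ n - unique_egf (Suc n) $ n) - (fps_log oo tree_egf (Suc n)) $ n\<bar> =
      \<bar>q * (2 * (seq_egf (Suc n) $ n - unique_egf (Suc n) $ n) - (fps_log oo tree_egf (Suc n)) $ n)\<bar>"
    using q by (simp add: abs_mult del: tree_egf.simps)
  also have "q * (2 * (seq_egf (Suc n) $ n - unique_egf (Suc n) $ n) - (fps_log oo tree_egf (Suc n)) $ n) =
      2 * (q * seq_egf (Suc n) $ n - q * unique_egf (Suc n) $ n) - q * (fps_log oo tree_egf (Suc n)) $ n"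
    by (simp add: algebra_simps del: tree_egf.simps)
  also have "\<dots> = 2 * (1 - P) - Q / real n"
    unfolding qs ql P[symmetric] ..
  finally have 1: "\<bar>2 * (1 - P) - Q / real n\<bar> \<le> 19 / real n" .
  have "\<bar>Q - sqrt (pi * real n / 2)\<bar> / real n \<le> 865 / real n"
    unfolding Q_def using n by (intro divide_right_mono fall_ratio_sum_bounds) auto
  then have 2: "\<bar>Q / real n - sqrt (pi * real n / 2) / real n\<bar> \<le> 865 / real n"
    by (simp add: diff_divide_distrib[symmetric])
  \<comment> \<open>Splitting off \<open>4\<close> supplies the factor 2 that matches
    \<open>2 * (1 - P)\<close>.\<close>
  have "sqrt (pi * real n / 2) = sqrt (4 * (pi / 8) * real n)"
    by simp
  also have "\<dots> = 2 * sqrt (pi / 8) * sqrt (real n)"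
    by (simp only: real_sqrt_mult real_sqrt_four)
  finally have "sqrt (pi * real n / 2) / real n = 2 * (sqrt (pi / 8) * (sqrt (real n) / real n))"
    by simp
  also have "sqrt (real n) / real n = real n powr (- 1 / 2)"
    using n by (simp add: powr_minus powr_half_sqrt real_div_sqrt divide_simps)
  finally have 3: "sqrt (pi * real n / 2) / real n = 2 * (sqrt (pi / 8) * real n powr (- 1 / 2))" .
  \<comment> \<open>The errors \<open>19\<close> and \<open>865\<close> add up to
    \<open>884\<close>, and halving gives \<open>442\<close>.\<close>
  have "\<bar>2 * (1 - P) - 2 * (sqrt (pi / 8) * real n powr (- 1 / 2))\<bar> \<le> 884 / real n"
    using 1 2 unfolding 3 by (simp add: abs_le_iff)
  then have "\<bar>P - (1 - sqrt (pi / 8) * real n powr (- 1 / 2))\<bar> \<le> 442 / real n"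
    by (simp add: abs_le_iff)
  moreover have "442 / real n = 442 * real n powr (- 1)"
    using n by (simp add: powr_minus divide_inverse)
  ultimately show ?thesis unfolding P_def by (simp only:)
qed

theorem theorem3:
  shows "(\<lambda>n. measure_pmf.prob (pmf_of_set (mappings n)) {g. unique_highest_tree n g}
            - (1 - sqrt (pi / 8) * real n powr (- 1 / 2)))
         \<in> O(\<lambda>n. real n powr (- 1))"
proof (rule bigoI)
  show "\<forall>\<^sub>F n in sequentially.
      norm (measure_pmf.prob (pmf_of_set (mappings n)) {g. unique_highest_tree n g}
            - (1 - sqrt (pi / 8) * real n powr (- 1 / 2))) \<le> 442 * norm (real n powr (- 1))"
    using eventually_ge_at_top[of 2]
    by eventually_elim (use unique_highest_prob_bound in simp)
qed

end
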